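(* Let $d\ge 2$, let $K\subset\mathbb{R}^d$ be a convex body with center at the point $0\in K$, let $\gamma\ge 0$ and let $u\ge 0$ be a fixed level. Assume the following. (1) $Z=\{Z(x,t):\ x\in\mathbb{R}^d,\ t\in\mathbb{R}\}$ is a measurable, mean-square continuous Gaussian random field, homogeneous and isotropic in space and stationary in time, with $\mathbb{E}[Z(x,t)]=0$, $\mathbb{E}[Z^2(x,t)]=1$ and $\mathbb{E}[Z(x,t)Z(y,s)]=C(\|x-y\|,|t-s|)\ge 0$. (2) $C(z,\tau)\to 0$ if $\max\{z,\tau\}\to\infty$. (3) There exist $\delta_1\in(0,1)$ and $\delta_2\in(0,1)$ such that $$\lim_{T\to\infty}\frac{\sigma_{1,K}^2(T)}{T^{1+\delta_1}\,T^{\gamma d(1+\delta_2)}}=\infty .$$ Let $M_1(T)=\int_0^T\int_{T^\gamma K}\mathbb{I}_{\{Z(x,t)\ge u\}}\,dx\,dt$. Then the random variable $$\frac{M_1(T)-(1-\Phi(u))\,|K|\,T^{1+\gamma d}}{\phi(u)\left[2|K|^2T^{1+2\gamma d}\int_0^T\left(1-\frac{\tau}{T}\right)\int_0^{\mathcal{D}(T^\gamma K)}C(z,\tau)\,\psi_{T^\gamma,K}(z)\,dz\,d\tau\right]^{1/2}}$$ converges in distribution to a standard normal distribution as $T\to\infty$.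
   Context: A convex body in $\mathbb{R}^d$ is a compact convex set with non-empty interior; $|K|$ is its Lebesgue measure. $T^\gamma K$ is the homothetic image of $K$ with center $0$ and scaling factor $T^\gamma$, and $\mathcal{D}(T^\gamma K)$ is its diameter. $\psi_{T^\gamma,K}$ is the probability density of $\|P_1-P_2\|$, where $P_1,P_2$ are independent and uniformly distributed in $T^\gamma K$. $\phi(w)=\frac{1}{\sqrt{2\pi}}e^{-w^2/2}$ and $\Phi(u)=\int_{-\infty}^u\phi(w)\,dw$. Also $$\sigma_{1,K}^2(T)=\operatorname{Var}\Big(\int_0^T\int_{T^\gamma K}Z(x,t)\,dx\,dt\Big)=2|K|^2T^{1+2\gamma d}\int_0^T\Big(1-\frac{\tau}{T}\Big)\int_0^{\mathcal{D}(T^\gamma K)}C(z,\tau)\,\psi_{T^\gamma,K}(z)\,dz\,d\tau .$$ The subordinating function $G_u(z)=\mathbb{I}_{\{z\ge u\}}$ is square integrable with respect to the standard Gaussian measure and has Hermite rank one, since $\int_{\mathbb{R}} G_u(z)\,z\,\phi(z)\,dz=\phi(u)\neq 0$. *)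

theory Defs
  imports "HOL-Probability.Probability"
begin

definition convex_body :: "'a::euclidean_space set \<Rightarrow> bool" where
  "convex_body K \<longleftrightarrow> compact K \<and> convex K \<and> interior K \<noteq> {}"

definition homothet :: "real \<Rightarrow> real \<Rightarrow> 'a::real_vector set \<Rightarrow> 'a set" where
  "homothet \<gamma> T K = (\<lambda>x. (T powr \<gamma>) *\<^sub>R x) ` K"

text \<open>
  The density with respect to Lebesgue measure of the distance between two independent points,
  each uniformly distributed in \<open>S\<close>. For a convex body \<open>S\<close> the law of the distance is
  absolutely continuous, so the Radon-Nikodym derivative is a genuine density; it is determined
  up to a null set, and it enters below only under an integral.
\<close>

definition distance_density :: "'a::euclidean_space set \<Rightarrow> real \<Rightarrow> real" where
  "distance_density S z =
     enn2real (RN_deriv lborel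
       (distr (uniform_measure lborel S \<Otimes>\<^sub>M uniform_measure lborel S) lborel
          (\<lambda>(p, q). norm (p - q))) z)"

text \<open>Constants count as (degenerate) Gaussian variables.\<close>

definition gaussian_rv :: "'w measure \<Rightarrow> ('w \<Rightarrow> real) \<Rightarrow> bool" where
  "gaussian_rv M X \<longleftrightarrow> X \<in> borel_measurable M \<and>
     ((\<exists>\<mu> \<sigma>. \<sigma> > 0 \<and> distributed M lborel X (normal_density \<mu> \<sigma>)) \<or>
      (\<exists>\<mu>. AE \<omega> in M. X \<omega> = \<mu>))"

text \<open>
  All finite-dimensional distributions are Gaussian, a random vector being Gaussian when every
  linear combination of its components is a Gaussian variable.
\<close>

definition gaussian_field ::
    "'w measure \<Rightarrow> ('a \<Rightarrow> real \<Rightarrow> 'w \<Rightarrow> real) \<Rightarrow> bool" where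
  "gaussian_field M Z \<longleftrightarrow>
     (\<forall>S a. finite S \<longrightarrow> gaussian_rv M (\<lambda>\<omega>. \<Sum>(x, t)\<in>S. a (x, t) * Z x t \<omega>))"

definition measurable_field ::
    "'w measure \<Rightarrow> ('a::euclidean_space \<Rightarrow> real \<Rightarrow> 'w \<Rightarrow> real) \<Rightarrow> bool" where
  "measurable_field M Z \<longleftrightarrow>
     (\<lambda>((x, t), \<omega>). Z x t \<omega>) \<in> borel_measurable ((borel :: ('a \<times> real) measure) \<Otimes>\<^sub>M M)"

definition mean_square_continuous ::
    "'w measure \<Rightarrow> ('a::euclidean_space \<Rightarrow> real \<Rightarrow> 'w \<Rightarrow> real) \<Rightarrow> bool" where
  "mean_square_continuous M Z \<longleftrightarrow>
     (\<forall>x t. (\<forall>y s. integrable M (\<lambda>\<omega>. (Z y s \<omega> - Z x t \<omega>)\<^sup>2)) \<and>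
            ((\<lambda>(y, s). prob_space.expectation M (\<lambda>\<omega>. (Z y s \<omega> - Z x t \<omega>)\<^sup>2)) \<longlongrightarrow> 0) (at (x, t)))"

text \<open>
  Invariance of the first two moments under rigid motions in space and shifts in time. For
  Gaussian fields this is equivalent to invariance of the finite-dimensional distributions.
\<close>

definition homogeneous_isotropic_stationary ::
    "'w measure \<Rightarrow> ('a::euclidean_space \<Rightarrow> real \<Rightarrow> 'w \<Rightarrow> real) \<Rightarrow> bool" where
  "homogeneous_isotropic_stationary M Z \<longleftrightarrow>
     (\<forall>R h r. orthogonal_transformation R \<longrightarrow>
        (\<forall>x t. prob_space.expectation M (Z (R x + h) (t + r)) = prob_space.expectation M (Z x t)) \<and>
        (\<forall>x t y s. prob_space.expectation M (\<lambda>\<omega>. Z (R x + h) (t + r) \<omega> * Z (R y + h) (s + r) \<omega>) =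
                   prob_space.expectation M (\<lambda>\<omega>. Z x t \<omega> * Z y s \<omega>)))"

definition sigma1_sq ::
    "'w measure \<Rightarrow> ('a::euclidean_space \<Rightarrow> real \<Rightarrow> 'w \<Rightarrow> real) \<Rightarrow> 'a set \<Rightarrow> real \<Rightarrow> real \<Rightarrow> real" where
  "sigma1_sq M Z K \<gamma> T =
     prob_space.variance M
       (\<lambda>\<omega>. LINT t:{0..T}|lborel. (LINT x:homothet \<gamma> T K|lborel. Z x t \<omega>))"

definition sojourn ::
    "('a::euclidean_space \<Rightarrow> real \<Rightarrow> 'w \<Rightarrow> real) \<Rightarrow> 'a set \<Rightarrow> real \<Rightarrow> real \<Rightarrow> real \<Rightarrow> 'w \<Rightarrow> real" where
  "sojourn Z K \<gamma> u T \<omega> =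
     (LINT t:{0..T}|lborel. (LINT x:homothet \<gamma> T K|lborel. indicator {u..} (Z x t \<omega>)))"

definition std_normal_cdf :: "real \<Rightarrow> real" where
  "std_normal_cdf u = (LINT w:{..u}|lborel. std_normal_density w)"

text \<open>The library's \<open>weak_conv_m\<close>, for families indexed by a filter instead of sequences.\<close>

definition converges_in_distribution ::
    "'w measure \<Rightarrow> ('i \<Rightarrow> 'w \<Rightarrow> real) \<Rightarrow> real measure \<Rightarrow> 'i filter \<Rightarrow> bool" where
  "converges_in_distribution M X N F \<longleftrightarrow>
     (\<forall>x. isCont (cdf N) x \<longrightarrow> ((\<lambda>i. cdf (distr M borel (X i)) x) \<longlongrightarrow> cdf N x) F)"

end

theory Submission
  imports Defs
begin

text \<open>
  The indicator splits as \<open>I{z \<ge> u} = (1 - \<Phi>(u)) + \<phi>(u) z + h(z)\<close>. The linear part contributes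
  \<open>\<phi>(u) \<integral> Z\<close>, which is exactly Gaussian, and its variance is a double integral of \<open>C\<close>. For covariance
  \<open>\<rho>\<close> one has \<open>|E h(X) h(Y)| \<le> const \<rho>\<^sup>2\<close>; since \<open>C \<rightarrow> 0\<close> at infinity, the variance of the remainder is at most
  \<open>\<epsilon>\<close> times the variance of \<open>\<integral> Z\<close> plus a constant times the measure of the pairs of nearby points, which
  is of the order of the volume \<open>T powr (1 + \<gamma> d)\<close> and hence negligible by the growth condition. So the characteristic function of
  the normalised functional converges to that of the Gaussian part, and Levy's continuity theorem applies.
\<close>

section \<open>Gaussian variables and the Hermite remainder\<close>

text \<open>All integrals are divided by the space-time volume \<open>V\<close>, so that they become
  means over a random point of the window. With \<open>c\<close> the mean of the covariance over two
  independent such points, the second moment of the averaged remainder is at most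
  \<open>\<epsilon> * c + D / V\<close>; relative to \<open>c\<close> everything therefore hinges on
  \<open>V * c\<close> tending to infinity. Two obstacles shape the rest. Gaussianity is given only
  for finite linear combinations, while the main term is a pathwise integral, so it has to be
  reached as an L2 limit of finite sums. The normalisation is written with a Radon-Nikodym
  derivative, which represents the law of the distance only once that law is known to be absolutely
  continuous; moreover \<open>C\<close> is specified only at nonnegative arguments, and its
  measurability has to be extracted from that of the field. Instead of a full Hermite expansion, the
  covariance of the remainder is bounded by conditioning on one variable and expanding the normal
  distribution function. This asks for \<open>\<rho> \<le> 1 / 2\<close>, which distant pairs
  satisfy.\<close>

lemma (in prob_space) gaussian_char_fun:
  assumes g: "gaussian_rv M X" and mean: "expectation X = 0"
  shows "expectation (\<lambda>\<omega>. iexp (X \<omega>)) = exp (- expectation (\<lambda>\<omega>. (X \<omega>)\<^sup>2) / 2)"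
proof -
  have [measurable]: "X \<in> borel_measurable M" using g by (simp add: gaussian_rv_def)
  from g consider (nd) \<mu> \<sigma> where "\<sigma> > 0" "distributed M lborel X (normal_density \<mu> \<sigma>)"
    | (const) \<mu> where "AE \<omega> in M. X \<omega> = \<mu>" unfolding gaussian_rv_def by blast
  then show ?thesis
  proof cases
    case nd
    have mu: "\<mu> = 0" using normal_distributed_expectation[OF nd] mean by simp
    have var: "expectation (\<lambda>\<omega>. (X \<omega>)\<^sup>2) = \<sigma>\<^sup>2"
      using normal_distributed_variance[OF nd] mean by simp
    have std: "distributed M lborel (\<lambda>x. X x / \<sigma>) std_normal_density"
      using nd mu normal_standard_normal_convert[of \<sigma> X \<mu>] by simp
    have "distr M lborel (\<lambda>x. X x / \<sigma>) = std_normal_distribution"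
      using std by (simp add: distributed_def)
    \<comment> \<open>The point of evaluation \<open>\<sigma>\<close> undoes the standardisation, so
      the value is the expectation of \<open>iexp X\<close> itself.\<close>
    then have "char (distr M lborel (\<lambda>x. X x / \<sigma>)) \<sigma> = exp (- \<sigma>\<^sup>2 / 2)"
      using char_std_normal_distribution by (simp add: fun_eq_iff)
    moreover have "char (distr M lborel (\<lambda>x. X x / \<sigma>)) \<sigma> = expectation (\<lambda>\<omega>. iexp (X \<omega>))"
      unfolding char_def using nd(1) by (subst integral_distr) auto
    ultimately show ?thesis by (simp add: var)
  next
    case const
    have "expectation X = \<mu>" using const by (subst integral_cong_AE[where g="\<lambda>_. \<mu>"]) (auto simp: prob_space)
    with mean have mu: "\<mu> = 0" by simp
    have a: "expectation (\<lambda>\<omega>. iexp (X \<omega>)) = expectation (\<lambda>_. 1)"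
      using const mu by (intro integral_cong_AE) auto
    have b: "expectation (\<lambda>\<omega>. (X \<omega>)\<^sup>2) = expectation (\<lambda>_. 0)"
      using const mu by (intro integral_cong_AE) auto
    show ?thesis unfolding a b by (simp add: prob_space)
  qed
qed

text \<open>Tilting \<open>M\<close> by the density \<open>g / expectation g\<close> turns the
  hypothesis into the characteristic function of \<open>X\<close> under the tilted measure, and
  Levy's uniqueness theorem identifies that law as standard normal. If \<open>expectation g\<close>
  vanishes there is nothing to tilt, but then \<open>g\<close> is zero almost everywhere. The
  conclusion is a form of independence: the weight does not affect the normal law of
  \<open>X\<close>.\<close>

lemma (in prob_space) weighted_normal_law:
  fixes g X :: "'a \<Rightarrow> real"
  assumes g: "integrable M g" "\<And>\<omega>. \<omega> \<in> space M \<Longrightarrow> 0 \<le> g \<omega>"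
    and [measurable]: "X \<in> borel_measurable M" "B \<in> sets borel"
    and ch: "\<And>t. expectation (\<lambda>\<omega>. g \<omega> * iexp (t * X \<omega>)) = expectation g * exp (- t\<^sup>2 / 2)"
  shows "expectation (\<lambda>\<omega>. g \<omega> * indicator B (X \<omega>)) =
    expectation g * measure std_normal_distribution B"
proof (cases "expectation g = 0")
  case True
  have "AE \<omega> in M. g \<omega> = 0"
    using integral_nonneg_eq_0_iff_AE[OF g(1)] g(2) True by auto
  then have "expectation (\<lambda>\<omega>. g \<omega> * indicator B (X \<omega>)) = expectation (\<lambda>_. 0)"
    using g(1) by (intro integral_cong_AE) auto
  with True show ?thesis by simp
next
  case False
  define m where "m = expectation g"
  have m: "m > 0" using False integral_nonneg_AE[of g M] g(2) by (auto simp: m_def less_le intro!: AE_I2)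
  have [measurable]: "g \<in> borel_measurable M" using g(1) by auto
  define Q where "Q = density M (\<lambda>\<omega>. g \<omega> / m)"
  have nnQ: "AE \<omega> in M. 0 \<le> g \<omega> / m" using g(2) m by (auto intro!: AE_I2)
  have Q: "prob_space Q"
  proof
    have "emeasure Q (space Q) = (\<integral>\<^sup>+\<omega>. g \<omega> / m \<partial>M)"
      by (auto simp: Q_def emeasure_density intro!: nn_integral_cong)
    also have "\<dots> = ennreal (expectation (\<lambda>\<omega>. g \<omega> / m))"
      using g m nnQ by (intro nn_integral_eq_integral) auto
    finally show "emeasure Q (space Q) = 1" using m by (simp add: m_def)
  qed
  interpret Q: prob_space Q by fact
  have [measurable]: "X \<in> borel_measurable Q" by (simp add: Q_def)
  have rd: "real_distribution (distr Q borel X)" by (intro Q.real_distribution_distr) simp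
  have "char (distr Q borel X) t = char std_normal_distribution t" for t
  proof -
    have "char (distr Q borel X) t = (CLINT \<omega>|Q. iexp (t * X \<omega>))"
      unfolding char_def by (subst integral_distr) auto
    also have "\<dots> = (CLINT \<omega>|M. (g \<omega> / m) *\<^sub>R iexp (t * X \<omega>))"
      unfolding Q_def using nnQ by (intro integral_density) auto
    also have "\<dots> = (CLINT \<omega>|M. (g \<omega> * iexp (t * X \<omega>)) / m)"
      by (intro Bochner_Integration.integral_cong) (auto simp: scaleR_conv_of_real)
    also have "\<dots> = exp (- t\<^sup>2 / 2)" using ch[of t] m by (simp add: m_def)
    finally show ?thesis by (simp add: char_std_normal_distribution)
  qed
  then have eq: "distr Q borel X = std_normal_distribution"
    by (intro Levy_uniqueness rd real_dist_normal_dist) auto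
  have "measure std_normal_distribution B = (LINT \<omega>|Q. indicator B (X \<omega>))"
    unfolding eq[symmetric]
    by (subst integral_distr[symmetric, where f="indicator B" and N=borel]) auto
  also have "\<dots> = (LINT \<omega>|M. (g \<omega> / m) *\<^sub>R indicator B (X \<omega>))"
    unfolding Q_def using nnQ by (intro integral_density) auto
  also have "\<dots> = expectation (\<lambda>\<omega>. g \<omega> * indicator B (X \<omega>)) / m" by simp
  finally show ?thesis using m by (simp add: m_def)
qed

section \<open>The bivariate standard normal law\<close>

lemma iexp_split: "iexp (x::real) = complex_of_real (cos x) + \<i> * complex_of_real (sin x)"
  by (simp add: exp_Euler cos_of_real sin_of_real)

text \<open>The one-dimensional uniqueness theorem suffices: it is applied to the law of \<open>X\<close> weighted by
  \<open>1 + cos (b W)\<close> and \<open>1 + sin (b W)\<close>, and then to the law of \<open>W\<close> weighted by an event of \<open>X\<close>.\<close>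

lemma (in prob_space) joint_std_normal_law:
  fixes X W :: "'a \<Rightarrow> real"
  assumes X[measurable]: "X \<in> borel_measurable M" and W[measurable]: "W \<in> borel_measurable M"
    and ch: "\<And>a b. expectation (\<lambda>\<omega>. iexp (a * X \<omega> + b * W \<omega>)) = exp (- (a\<^sup>2 + b\<^sup>2) / 2)"
  shows "distr M (borel \<Otimes>\<^sub>M borel) (\<lambda>\<omega>. (X \<omega>, W \<omega>)) =
    std_normal_distribution \<Otimes>\<^sub>M std_normal_distribution"
proof -
  interpret N: real_distribution std_normal_distribution by (rule real_dist_normal_dist)
  have int: "integrable M (\<lambda>\<omega>. f \<omega> :: complex)" if [measurable]: "f \<in> borel_measurable M" and "\<And>\<omega>. norm (f \<omega>) \<le> 2" for f
    using that by (intro integrable_const_bound[where B=2]) auto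
  have intr: "integrable M (\<lambda>\<omega>. f \<omega> :: real)" if [measurable]: "f \<in> borel_measurable M" and "\<And>\<omega>. norm (f \<omega>) \<le> 2" for f
    using that by (intro integrable_const_bound[where B=2]) auto
  \<comment> \<open>The cosine is half the sum of two exponentials, so the joint characteristic
    function at \<open>(t, b)\<close> and \<open>(t, - b)\<close> suffices; it is even in
    \<open>b\<close>, which is why the sine analogue below is 0.\<close>
  have ccos: "expectation (\<lambda>\<omega>. complex_of_real (cos (b * W \<omega>)) * iexp (t * X \<omega>)) = exp (- (t\<^sup>2 + b\<^sup>2) / 2)" for b t
  proof -
    have "complex_of_real (cos (b * w)) * iexp (t * x) = (iexp (t * x + b * w) + iexp (t * x + (- b) * w)) / 2" for x w
      by (simp only: iexp_split) (simp add: complex_eq_iff cos_add sin_add cos_diff sin_diff Re_divide Im_divide power2_eq_square)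
    then have "expectation (\<lambda>\<omega>. complex_of_real (cos (b * W \<omega>)) * iexp (t * X \<omega>)) =
      expectation (\<lambda>\<omega>. (iexp (t * X \<omega> + b * W \<omega>) + iexp (t * X \<omega> + (- b) * W \<omega>)) / 2)" by presburger
    also have "\<dots> = (expectation (\<lambda>\<omega>. iexp (t * X \<omega> + b * W \<omega>)) + expectation (\<lambda>\<omega>. iexp (t * X \<omega> + (- b) * W \<omega>))) / 2"
      by (subst Bochner_Integration.integral_add[symmetric]) (auto intro!: int simp del: of_real_mult of_real_add)
    also have "\<dots> = exp (- (t\<^sup>2 + b\<^sup>2) / 2)" unfolding ch by simp
    finally show ?thesis .
  qed
  have csin: "expectation (\<lambda>\<omega>. complex_of_real (sin (b * W \<omega>)) * iexp (t * X \<omega>)) = 0" for b t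
  proof -
    have "complex_of_real (sin (b * w)) * iexp (t * x) = (iexp (t * x + b * w) - iexp (t * x + (- b) * w)) / (2 * \<i>)" for x w
      by (simp only: iexp_split) (simp add: complex_eq_iff cos_add sin_add cos_diff sin_diff Re_divide Im_divide power2_eq_square)
    then have "expectation (\<lambda>\<omega>. complex_of_real (sin (b * W \<omega>)) * iexp (t * X \<omega>)) =
      expectation (\<lambda>\<omega>. (iexp (t * X \<omega> + b * W \<omega>) - iexp (t * X \<omega> + (- b) * W \<omega>)) / (2 * \<i>))" by presburger
    also have "\<dots> = (expectation (\<lambda>\<omega>. iexp (t * X \<omega> + b * W \<omega>)) - expectation (\<lambda>\<omega>. iexp (t * X \<omega> + (- b) * W \<omega>))) / (2 * \<i>)"
      by (subst Bochner_Integration.integral_diff[symmetric]) (auto intro!: int simp del: of_real_mult of_real_add)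
    also have "\<dots> = 0" unfolding ch by simp
    finally show ?thesis .
  qed
  have cX: "expectation (\<lambda>\<omega>. iexp (t * X \<omega>)) = exp (- t\<^sup>2 / 2)" for t
    using ccos[of 0 t] by simp
  have mcos: "expectation (\<lambda>\<omega>. cos (b * W \<omega>)) = exp (- b\<^sup>2 / 2)" for b
  proof -
    have "complex_of_real (expectation (\<lambda>\<omega>. cos (b * W \<omega>))) = complex_of_real (exp (- b\<^sup>2 / 2))"
      using ccos[of b 0] by simp
    then show ?thesis using of_real_eq_iff by blast
  qed
  have msin: "expectation (\<lambda>\<omega>. sin (b * W \<omega>)) = 0" for b
  proof -
    have "complex_of_real (expectation (\<lambda>\<omega>. sin (b * W \<omega>))) = 0"
      using csin[of b 0] by simp
    then show ?thesis using of_real_eq_0_iff by blast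
  qed
  let ?N = "measure std_normal_distribution"
  have PX: "expectation (\<lambda>\<omega>. indicator B (X \<omega>)) = ?N B" if [measurable]: "B \<in> sets borel" for B
  proof -
    have "expectation (\<lambda>\<omega>. 1 * indicator B (X \<omega>)) = expectation (\<lambda>\<omega>. 1) * ?N B"
      using cX by (intro weighted_normal_law) (auto simp: prob_space)
    then show ?thesis by (simp add: prob_space)
  qed
  \<comment> \<open>The summand 1 makes the weight nonnegative, as
    \<open>weighted_normal_law\<close> demands; its own contribution is \<open>PX\<close>, which is
    subtracted at the end.\<close>
  have indcos: "expectation (\<lambda>\<omega>. cos (b * W \<omega>) * indicator B (X \<omega>)) = exp (- b\<^sup>2 / 2) * ?N B"
    if [measurable]: "B \<in> sets borel" for B b
  proof -
    have m1: "expectation (\<lambda>\<omega>. 1 + cos (b * W \<omega>)) = 1 + exp (- b\<^sup>2 / 2)"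
      using mcos[of b] by (subst Bochner_Integration.integral_add) (auto intro!: intr simp: prob_space abs_cos_le_one order_trans[OF abs_cos_le_one])
    have "expectation (\<lambda>\<omega>. (1 + cos (b * W \<omega>)) * indicator B (X \<omega>)) = expectation (\<lambda>\<omega>. 1 + cos (b * W \<omega>)) * ?N B"
    proof (rule weighted_normal_law)
      show "integrable M (\<lambda>\<omega>. 1 + cos (b * W \<omega>))"
        by (intro Bochner_Integration.integrable_add intr) (auto intro: order_trans[OF abs_cos_le_one])
      show "0 \<le> 1 + cos (b * W \<omega>)" for \<omega> using cos_ge_minus_one[of "b * W \<omega>"] by linarith
      show "expectation (\<lambda>\<omega>. complex_of_real (1 + cos (b * W \<omega>)) * iexp (t * X \<omega>)) =
          complex_of_real (expectation (\<lambda>\<omega>. 1 + cos (b * W \<omega>)) * exp (- t\<^sup>2 / 2))" for t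
      proof -
        have "expectation (\<lambda>\<omega>. complex_of_real (1 + cos (b * W \<omega>)) * iexp (t * X \<omega>)) =
           expectation (\<lambda>\<omega>. iexp (t * X \<omega>) + complex_of_real (cos (b * W \<omega>)) * iexp (t * X \<omega>))"
          by (simp add: ring_distribs)
        also have "\<dots> = complex_of_real (exp (- t\<^sup>2 / 2)) + complex_of_real (exp (- (t\<^sup>2 + b\<^sup>2) / 2))"
          unfolding cX[symmetric] ccos[symmetric]
          by (rule Bochner_Integration.integral_add; intro int)
             (auto simp: norm_mult order_trans[OF abs_cos_le_one])
        finally have "expectation (\<lambda>\<omega>. complex_of_real (1 + cos (b * W \<omega>)) * iexp (t * X \<omega>)) =
            complex_of_real (exp (- t\<^sup>2 / 2)) + complex_of_real (exp (- (t\<^sup>2 + b\<^sup>2) / 2))" .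
        moreover have "exp (- (t\<^sup>2 + b\<^sup>2) / 2) = exp (- b\<^sup>2 / 2) * exp (- t\<^sup>2 / 2)"
          by (simp add: exp_add[symmetric] add_divide_distrib[symmetric])
        ultimately show ?thesis unfolding m1
          by (simp only: of_real_add of_real_mult ring_distribs of_real_1 mult_1_left)
      qed
    qed auto
    moreover have "expectation (\<lambda>\<omega>. (1 + cos (b * W \<omega>)) * indicator B (X \<omega>)) = expectation (\<lambda>\<omega>. indicator B (X \<omega>)) + expectation (\<lambda>\<omega>. cos (b * W \<omega>) * indicator B (X \<omega>))"
      unfolding ring_distribs mult_1_left
      by (rule Bochner_Integration.integral_add; intro intr) (auto simp: abs_mult indicator_def order_trans[OF abs_cos_le_one])
    ultimately show ?thesis using m1 PX[of B] by (simp add: ring_distribs)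
  qed
  have indsin: "expectation (\<lambda>\<omega>. sin (b * W \<omega>) * indicator B (X \<omega>)) = 0"
    if [measurable]: "B \<in> sets borel" for B b
  proof -
    have m1: "expectation (\<lambda>\<omega>. 1 + sin (b * W \<omega>)) = 1"
      using msin[of b] by (subst Bochner_Integration.integral_add) (auto intro!: intr simp: prob_space order_trans[OF abs_sin_le_one])
    have "expectation (\<lambda>\<omega>. (1 + sin (b * W \<omega>)) * indicator B (X \<omega>)) = expectation (\<lambda>\<omega>. 1 + sin (b * W \<omega>)) * ?N B"
    proof (rule weighted_normal_law)
      show "integrable M (\<lambda>\<omega>. 1 + sin (b * W \<omega>))"
        by (intro Bochner_Integration.integrable_add intr) (auto intro: order_trans[OF abs_sin_le_one])
      show "0 \<le> 1 + sin (b * W \<omega>)" for \<omega> using sin_ge_minus_one[of "b * W \<omega>"] by linarith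
      show "expectation (\<lambda>\<omega>. complex_of_real (1 + sin (b * W \<omega>)) * iexp (t * X \<omega>)) =
          complex_of_real (expectation (\<lambda>\<omega>. 1 + sin (b * W \<omega>)) * exp (- t\<^sup>2 / 2))" for t
      proof -
        have "expectation (\<lambda>\<omega>. complex_of_real (1 + sin (b * W \<omega>)) * iexp (t * X \<omega>)) =
           expectation (\<lambda>\<omega>. iexp (t * X \<omega>) + complex_of_real (sin (b * W \<omega>)) * iexp (t * X \<omega>))"
          by (simp add: ring_distribs)
        also have "\<dots> = complex_of_real (exp (- t\<^sup>2 / 2)) + 0"
          unfolding cX[symmetric] csin[symmetric, of b t]
          by (rule Bochner_Integration.integral_add; intro int)
             (auto simp: norm_mult order_trans[OF abs_sin_le_one])
        finally show ?thesis unfolding m1 by simp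
      qed
    qed auto
    moreover have "expectation (\<lambda>\<omega>. (1 + sin (b * W \<omega>)) * indicator B (X \<omega>)) = expectation (\<lambda>\<omega>. indicator B (X \<omega>)) + expectation (\<lambda>\<omega>. sin (b * W \<omega>) * indicator B (X \<omega>))"
      unfolding ring_distribs mult_1_left
      by (rule Bochner_Integration.integral_add; intro intr) (auto simp: abs_mult indicator_def order_trans[OF abs_sin_le_one])
    ultimately show ?thesis using m1 PX[of B] by simp
  qed
  \<comment> \<open>Now the weight is an event of \<open>X\<close> and the law to be identified is
    that of \<open>W\<close>; \<open>indcos\<close> and \<open>indsin\<close> supply the real and
    the imaginary part of the required characteristic function.\<close>
  have joint: "expectation (\<lambda>\<omega>. indicator A (X \<omega>) * indicator B (W \<omega>)) = ?N A * ?N B"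
    if [measurable]: "A \<in> sets borel" "B \<in> sets borel" for A B
    unfolding PX[OF that(1), symmetric]
  proof (rule weighted_normal_law)
    show "integrable M (\<lambda>\<omega>. indicat_real A (X \<omega>))"
      by (intro intr) (auto simp: indicator_def)
    show "expectation (\<lambda>\<omega>. complex_of_real (indicat_real A (X \<omega>)) * iexp (t * W \<omega>)) =
         complex_of_real (expectation (\<lambda>\<omega>. indicator A (X \<omega>)) * exp (- t\<^sup>2 / 2))" for t
    proof -
      have "expectation (\<lambda>\<omega>. complex_of_real (indicat_real A (X \<omega>)) * iexp (t * W \<omega>)) =
         expectation (\<lambda>\<omega>. complex_of_real (cos (t * W \<omega>) * indicat_real A (X \<omega>)) + 
            \<i> * complex_of_real (sin (t * W \<omega>) * indicat_real A (X \<omega>)))"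
        by (intro Bochner_Integration.integral_cong) (auto simp: iexp_split ring_distribs simp del: of_real_mult split: split_indicator)
      also have "\<dots> = expectation (\<lambda>\<omega>. complex_of_real (cos (t * W \<omega>) * indicat_real A (X \<omega>))) + 
            expectation (\<lambda>\<omega>. \<i> * complex_of_real (sin (t * W \<omega>) * indicat_real A (X \<omega>)))"
        by (rule Bochner_Integration.integral_add; intro int)
          (auto simp: norm_mult indicator_def order_trans[OF abs_sin_le_one] order_trans[OF abs_cos_le_one])
      also have "\<dots> = exp (- t\<^sup>2 / 2) * ?N A"
        unfolding integral_complex_of_real integral_mult_right_zero indcos[OF that(1)] indsin[OF that(1)] by simp
      finally show ?thesis unfolding PX[OF that(1)] by (simp add: mult.commute)
    qed
  qed (auto simp: that)
  show ?thesis
  proof (rule pair_measure_eqI[symmetric])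
    fix A B assume "A \<in> sets std_normal_distribution" "B \<in> sets std_normal_distribution"
    then have [measurable]: "A \<in> sets borel" "B \<in> sets borel" by auto
    have "?N A * ?N B = expectation (indicator ((\<lambda>\<omega>. (X \<omega>, W \<omega>)) -` (A \<times> B) \<inter> space M))"
      unfolding joint[OF \<open>A \<in> sets borel\<close> \<open>B \<in> sets borel\<close>, symmetric]
      by (intro Bochner_Integration.integral_cong) (auto split: split_indicator)
    also have "\<dots> = prob ((\<lambda>\<omega>. (X \<omega>, W \<omega>)) -` (A \<times> B) \<inter> space M)" by simp
    finally show "emeasure std_normal_distribution A * emeasure std_normal_distribution B =
         emeasure (distr M (borel \<Otimes>\<^sub>M borel) (\<lambda>\<omega>. (X \<omega>, W \<omega>))) (A \<times> B)"
      by (subst emeasure_distr) (auto simp: N.emeasure_eq_measure emeasure_eq_measure ennreal_mult[symmetric])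
  qed (auto intro!: sets_pair_measure_cong N.sigma_finite_measure_axioms)
qed

section \<open>The normal distribution function to second order and the Hermite remainder\<close>

lemma std_normal_density_le_1: "std_normal_density x \<le> 1"
proof -
  have "1 \<le> sqrt (2 * pi)" using pi_gt3 by simp
  then have "1 / sqrt (2 * pi) \<le> 1" by simp
  moreover have "exp (- x\<^sup>2 / 2) \<le> 1" by simp
  ultimately show ?thesis unfolding std_normal_density_def
    by (intro mult_le_one) auto
qed

text \<open>The derivative has absolute value \<open>\<bar>z\<bar>\<close> times the density, and
  \<open>\<bar>z\<bar> \<le> 1 + z\<^sup>2 / 2 \<le> exp (z\<^sup>2 / 2)\<close> cancels the
  exponential. The constant 1 is generous, the prefactor of the density being below 1/2.\<close>

lemma std_normal_density_lipschitz: "\<bar>std_normal_density x - std_normal_density y\<bar> \<le> \<bar>x - y\<bar>"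
proof -
  have der: "(std_normal_density has_field_derivative (- z * std_normal_density z)) (at z)" for z
    unfolding std_normal_density_def by (rule derivative_eq_intros refl | simp)+
  have bound: "norm (- z * std_normal_density z) \<le> 1" for z :: real
  proof -
    have "1 + z\<^sup>2 / 2 \<le> exp (z\<^sup>2 / 2)" by (rule exp_ge_add_one_self)
    moreover have "\<bar>z\<bar> \<le> 1 + z\<^sup>2 / 2"
      using zero_le_power2[of "\<bar>z\<bar> - 1"] by (simp add: power2_diff)
    ultimately have "\<bar>z\<bar> \<le> exp (z\<^sup>2 / 2)" by linarith
    then have 1: "\<bar>z\<bar> * exp (- z\<^sup>2 / 2) \<le> 1" by (simp add: exp_minus field_simps)
    have "1 \<le> sqrt (2 * pi)" using pi_gt3 by simp
    then have 2: "1 / sqrt (2 * pi) \<le> 1" by simp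
    have "norm (- z * std_normal_density z) = 1 / sqrt (2 * pi) * (\<bar>z\<bar> * exp (- z\<^sup>2 / 2))"
      by (simp add: std_normal_density_def abs_mult)
    also have "\<dots> \<le> 1" by (rule mult_le_one[OF 2 _ 1]) simp
    finally show ?thesis .
  qed
  have "norm (std_normal_density x - std_normal_density y) \<le> 1 * norm (x - y)"
    by (rule field_differentiable_bound[where S=UNIV and f'="\<lambda>z. - z * std_normal_density z"])
      (use der bound in auto)
  then show ?thesis by simp
qed

lemma set_integrable_std_normal_density:
  "A \<in> sets borel \<Longrightarrow> set_integrable lborel A std_normal_density"
  unfolding set_integrable_def
  by (rule integrable_mult_indicator[OF _ integrable_normal_density]) auto

text \<open>A Lipschitz density makes the first-order expansion of its distribution function
  accurate to second order: the error is the integral of the density minus its value at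
  \<open>u\<close>, and integrand and interval are both of size at most
  \<open>\<bar>y - u\<bar>\<close>.\<close>

lemma std_normal_cdf_taylor:
  "\<bar>std_normal_cdf y - std_normal_cdf u - std_normal_density u * (y - u)\<bar> \<le> (y - u)\<^sup>2"
proof -
  \<comment> \<open>The base point \<open>c\<close> may sit at either end of the interval, which
    covers both orders of \<open>u\<close> and \<open>y\<close> without signed integrals.\<close>
  have *: "\<bar>std_normal_cdf b - std_normal_cdf a - std_normal_density c * (b - a)\<bar> \<le> (b - a)\<^sup>2"
    if "a \<le> c" "c \<le> b" for a b c
  proof -
    have "std_normal_cdf b = std_normal_cdf a + (LINT w:{a<..b}|lborel. std_normal_density w)"
      unfolding std_normal_cdf_def using that
      by (subst set_integral_Un[symmetric]) (auto intro!: set_integrable_std_normal_density simp: ivl_disj_un_one)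
    moreover have "std_normal_density c * (b - a) = (LINT w:{a<..b}|lborel. std_normal_density c)"
      using that by (simp add: set_lebesgue_integral_def)
    moreover have ic: "set_integrable lborel {a<..b} (\<lambda>_. k)" for k :: real
      unfolding set_integrable_def by (intro integrable_scaleR_left integrable_real_indicator) (use that in auto)
    ultimately have "std_normal_cdf b - std_normal_cdf a - std_normal_density c * (b - a)
        = (LINT w:{a<..b}|lborel. std_normal_density w - std_normal_density c)"
      by (subst set_integral_diff) (auto intro!: set_integrable_std_normal_density)
    also have "\<bar>\<dots>\<bar> \<le> (LINT w:{a<..b}|lborel. \<bar>std_normal_density w - std_normal_density c\<bar>)"
      using set_integral_norm_bound[OF set_integral_diff(1)[OF set_integrable_std_normal_density ic], of "std_normal_density c"]
      by simp
    also have "\<dots> \<le> (LINT w:{a<..b}|lborel. b - a)"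
    proof (rule set_integral_mono)
      show "set_integrable lborel {a<..b} (\<lambda>w. \<bar>std_normal_density w - std_normal_density c\<bar>)"
        using ic by (intro set_integrable_abs set_integral_diff) (auto intro!: set_integrable_std_normal_density)
      show "\<bar>std_normal_density w - std_normal_density c\<bar> \<le> b - a" if "w \<in> {a<..b}" for w
        using std_normal_density_lipschitz[of w c] that \<open>a \<le> c\<close> \<open>c \<le> b\<close> by auto
    qed (rule ic)
    also have "\<dots> = (b - a)\<^sup>2"
      using that by (simp add: set_lebesgue_integral_def power2_eq_square)
    finally show ?thesis .
  qed
  show ?thesis
  proof (cases "u \<le> y")
    case True then show ?thesis using *[of u u y] by simp
  next
    case False
    have "\<bar>std_normal_cdf y - std_normal_cdf u - std_normal_density u * (y - u)\<bar> =
      \<bar>std_normal_cdf u - std_normal_cdf y - std_normal_density u * (u - y)\<bar>"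
      by (simp add: algebra_simps abs_minus_commute)
    then show ?thesis using *[of y u u] False by (simp add: power2_commute)
  qed
qed

lemma measure_std_normal_atLeast: "measure std_normal_distribution {y..} = 1 - std_normal_cdf y"
proof -
  interpret N: real_distribution std_normal_distribution by (rule real_dist_normal_dist)
  have meas: "measure std_normal_distribution A = (LINT w:A|lborel. std_normal_density w)" if "A \<in> sets borel" for A
  proof -
    have "measure std_normal_distribution A = (LINT w|std_normal_distribution. indicator A w)"
      using that by simp
    also have "\<dots> = (LINT w|lborel. std_normal_density w *\<^sub>R indicator A w)"
      using that by (intro integral_density) auto
    finally show ?thesis by (simp add: set_lebesgue_integral_def mult.commute)
  qed
  have "measure std_normal_distribution {y..} = 1 - measure std_normal_distribution {..<y}"
  proof -
    have "space std_normal_distribution - {..<y} = {y..}" by auto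
    then show ?thesis using N.prob_compl[of "{..<y}"] by simp
  qed
  also have "measure std_normal_distribution {..<y} = measure std_normal_distribution {..y}"
  proof -
    have "(LINT w:{..y}|lborel. std_normal_density w) = (LINT w:{..<y}|lborel. std_normal_density w)"
      using AE_lborel_singleton[of y] unfolding set_lebesgue_integral_def
      by (intro integral_cong_AE) (auto split: split_indicator)
    then show ?thesis by (simp add: meas)
  qed
  finally show ?thesis by (simp add: meas std_normal_cdf_def)
qed

text \<open>The part of \<open>z \<mapsto> I{z \<ge> u}\<close> of Hermite rank at least two.\<close>

definition hermite_remainder :: "real \<Rightarrow> real \<Rightarrow> real" where
  "hermite_remainder u z = indicator {u..} z - (1 - std_normal_cdf u) - std_normal_density u * z"

lemma borel_measurable_hermite_remainder [measurable]: "hermite_remainder u \<in> borel_measurable borel"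
  unfolding hermite_remainder_def[abs_def] by measurable

lemma std_normal_cdf_bounds: "0 \<le> std_normal_cdf u" "std_normal_cdf u \<le> 1"
proof -
  interpret N: real_distribution std_normal_distribution by (rule real_dist_normal_dist)
  show "0 \<le> std_normal_cdf u" "std_normal_cdf u \<le> 1"
    using measure_std_normal_atLeast[of u] N.prob_le_1[of "{u..}"] measure_nonneg[of std_normal_distribution "{u..}"]
    by linarith+
qed

lemma abs_hermite_remainder_le: "\<bar>hermite_remainder u z\<bar> \<le> 1 + \<bar>z\<bar>"
proof -
  have "std_normal_density u * \<bar>z\<bar> \<le> 1 * \<bar>z\<bar>"
    by (intro mult_right_mono std_normal_density_le_1) auto
  then have "\<bar>std_normal_density u * z\<bar> \<le> \<bar>z\<bar>" by (simp add: abs_mult)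
  moreover have "\<bar>indicator {u..} z - (1 - std_normal_cdf u)\<bar> \<le> 1"
    using std_normal_cdf_bounds[of u] by (auto split: split_indicator)
  ultimately show ?thesis unfolding hermite_remainder_def by linarith
qed

text \<open>Crude, but it turns the unit variance of the field into the second moment bound 4 for
  the remainder.\<close>

lemma hermite_remainder_sq_le: "(hermite_remainder u z)\<^sup>2 \<le> 2 + 2 * z\<^sup>2"
proof -
  have "(hermite_remainder u z)\<^sup>2 \<le> (1 + \<bar>z\<bar>)\<^sup>2"
    using abs_hermite_remainder_le[of u z] by (intro abs_le_square_iff[THEN iffD1]) simp
  also have "\<dots> \<le> 2 + 2 * z\<^sup>2"
    using zero_le_power2[of "1 - \<bar>z\<bar>"] by (simp add: power2_sum power2_diff)
  finally show ?thesis .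
qed

text \<open>Given the first variable \<open>x\<close>, the second one reaches \<open>u\<close>
  exactly when \<open>w\<close> reaches \<open>y = (u - \<rho> * x) / s\<close>. The conditional
  mean is therefore built from the Taylor error of the distribution function between
  \<open>u\<close> and \<open>y\<close> and from the amount by which \<open>y - u\<close> misses its
  linear prediction \<open>- \<rho> * x\<close>. The first is quadratic in \<open>y - u\<close>,
  hence in \<open>\<rho>\<close>; the second is due to \<open>1 / s\<close>, which differs from 1
  only by order \<open>\<rho>\<^sup>2\<close>.\<close>

lemma conditional_hermite_remainder_bound:
  assumes \<rho>: "0 \<le> \<rho>" "\<rho> \<le> 1 / 2" and s: "s = sqrt (1 - \<rho>\<^sup>2)" and u: "u \<ge> 0"
  shows "\<bar>LINT w|std_normal_distribution. hermite_remainder u (\<rho> * x + s * w)\<bar> \<le> \<rho>\<^sup>2 * ((u + 2 * \<bar>x\<bar>)\<^sup>2 + u + \<bar>x\<bar>)"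
proof -
  interpret N: real_distribution std_normal_distribution by (rule real_dist_normal_dist)
  have r2: "\<rho>\<^sup>2 \<le> 1/4" using power_mono[OF \<rho>(2,1), of 2] by (simp add: power2_eq_square)
  have s0: "s > 0" "s\<^sup>2 = 1 - \<rho>\<^sup>2" "s \<le> 1" using r2 by (auto simp: s)
  define y where "y = (u - \<rho> * x) / s"
  have iw: "integrable std_normal_distribution (\<lambda>w. w)" and mw: "(LINT w|std_normal_distribution. w) = 0"
    using integrable_std_normal_distribution_moment[of 1] integral_std_normal_distribution_moment_odd[of 1] by auto
  have ind: "indicator {u..} (\<rho> * x + s * w) = (indicator {y..} w :: real)" for w
    using s0 by (auto simp: y_def field_simps split: split_indicator)
  have "(LINT w|std_normal_distribution. hermite_remainder u (\<rho> * x + s * w)) =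
      (LINT w|std_normal_distribution. indicator {y..} w - ((1 - std_normal_cdf u) + std_normal_density u * \<rho> * x) - (std_normal_density u * s) * w)"
    unfolding hermite_remainder_def ind by (simp add: algebra_simps)
  also have "\<dots> = (1 - std_normal_cdf y) - ((1 - std_normal_cdf u) + std_normal_density u * \<rho> * x)"
  proof -
    have "integrable std_normal_distribution (indicat_real {y..})"
      by (intro integrable_real_indicator) (auto simp: N.emeasure_eq_measure)
    then show ?thesis using iw mw N.prob_space by (simp add: measure_std_normal_atLeast)
  qed
  finally have eq: "(LINT w|std_normal_distribution. hermite_remainder u (\<rho> * x + s * w)) =
     - (std_normal_cdf y - std_normal_cdf u - std_normal_density u * (y - u)) - std_normal_density u * (y - u + \<rho> * x)"
    by (simp add: algebra_simps)
  \<comment> \<open>The upper bound follows by squaring: since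
    \<open>\<rho>\<^sup>2 \<le> 1 / 4\<close>, the number
    \<open>(1 + \<rho>\<^sup>2)\<^sup>2 * (1 - \<rho>\<^sup>2)\<close> is 1 plus
    \<open>\<rho>\<^sup>2\<close> times a nonnegative factor.\<close>
  have si: "1 \<le> 1 / s" "1 / s \<le> 1 + \<rho>\<^sup>2"
  proof -
    show "1 \<le> 1 / s" using s0 by simp
    have "1 \<le> (1 + \<rho>\<^sup>2) * s"
    proof (rule power2_le_imp_le)
      have "((1 + \<rho>\<^sup>2) * s)\<^sup>2 = 1 + \<rho>\<^sup>2 * (1 - \<rho>\<^sup>2 - \<rho>\<^sup>2 * \<rho>\<^sup>2)"
        by (simp add: power_mult_distrib s0) (simp add: algebra_simps power4_eq_xxxx power2_eq_square)
      moreover have "\<rho>\<^sup>2 * \<rho>\<^sup>2 \<le> 1/4 * (1/4)" using r2 by (intro mult_mono) auto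
      then have "0 \<le> 1 - \<rho>\<^sup>2 - \<rho>\<^sup>2 * \<rho>\<^sup>2" using r2 by linarith
      ultimately show "1\<^sup>2 \<le> ((1 + \<rho>\<^sup>2) * s)\<^sup>2" by simp
    qed (use s0 in auto)
    then show "1 / s \<le> 1 + \<rho>\<^sup>2" using s0 by (simp add: field_simps)
  qed
  define a where "a = 1 / s - 1"
  have a: "0 \<le> a" "a \<le> \<rho>\<^sup>2" using si by (auto simp: a_def)
  \<comment> \<open>This separates the linear part \<open>- \<rho> * x\<close> from terms that carry
    the factor \<open>a\<close> of order \<open>\<rho>\<^sup>2\<close>.\<close>
  have yu: "y - u = u * a - \<rho> * x * (1 + a)" using s0 by (simp add: y_def a_def field_simps)
  have r1: "\<rho>\<^sup>2 \<le> \<rho>" using \<rho> by (simp add: power2_eq_square mult_left_le)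
  have "\<bar>y - u\<bar> \<le> \<bar>u * a\<bar> + \<bar>\<rho> * x * (1 + a)\<bar>" unfolding yu by (rule abs_triangle_ineq4)
  also have "\<bar>u * a\<bar> \<le> u * \<rho>" using u a r1 by (auto simp: abs_mult intro!: mult_left_mono)
  also have "\<bar>\<rho> * x * (1 + a)\<bar> \<le> \<rho> * \<bar>x\<bar> * 2" using \<rho> a r2 by (auto simp: abs_mult intro!: mult_left_mono)
  finally have ay: "\<bar>y - u\<bar> \<le> \<rho> * (u + 2 * \<bar>x\<bar>)" by (simp add: algebra_simps)
  have "(y - u)\<^sup>2 \<le> (\<rho> * (u + 2 * \<bar>x\<bar>))\<^sup>2"
    using ay by (intro abs_le_square_iff[THEN iffD1]) (use \<rho> u in auto)
  then have t1: "\<bar>std_normal_cdf y - std_normal_cdf u - std_normal_density u * (y - u)\<bar> \<le> \<rho>\<^sup>2 * (u + 2 * \<bar>x\<bar>)\<^sup>2"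
    using std_normal_cdf_taylor[of y u] by (simp add: power_mult_distrib)
  have "\<bar>y - u + \<rho> * x\<bar> = \<bar>u * a - \<rho> * x * a\<bar>" unfolding yu by (simp add: algebra_simps)
  also have "\<dots> \<le> \<bar>u * a\<bar> + \<bar>\<rho> * x * a\<bar>" by (rule abs_triangle_ineq4)
  also have "\<bar>u * a\<bar> \<le> u * \<rho>\<^sup>2" using u a by (auto simp: abs_mult intro!: mult_left_mono)
  also have "\<bar>\<rho> * x * a\<bar> \<le> (1 * \<bar>x\<bar>) * \<rho>\<^sup>2" unfolding abs_mult using \<rho> a by (intro mult_mono) auto
  finally have t2: "\<bar>y - u + \<rho> * x\<bar> \<le> \<rho>\<^sup>2 * (u + \<bar>x\<bar>)" by (simp add: algebra_simps)
  have "std_normal_density u * \<bar>y - u + \<rho> * x\<bar> \<le> 1 * (\<rho>\<^sup>2 * (u + \<bar>x\<bar>))"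
    using t2 std_normal_density_le_1 by (intro mult_mono) auto
  then have t3: "\<bar>std_normal_density u * (y - u + \<rho> * x)\<bar> \<le> \<rho>\<^sup>2 * (u + \<bar>x\<bar>)" by (simp add: abs_mult)
  show ?thesis unfolding eq using t1 t3 by (simp add: algebra_simps)
qed

text \<open>The bound \<open>1 + \<bar>x\<bar>\<close> for the remainder at \<open>x\<close> times
  the conditional bound stripped of \<open>\<rho>\<^sup>2\<close>, averaged over \<open>x\<close>.
  The integrand is a cubic in \<open>\<bar>x\<bar>\<close>, so the value is finite.\<close>

definition hermite_remainder_const :: "real \<Rightarrow> real" where
  "hermite_remainder_const u = (LINT x|std_normal_distribution. (1 + \<bar>x\<bar>) * ((u + 2 * \<bar>x\<bar>)\<^sup>2 + u + \<bar>x\<bar>))"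

lemma integrable_hermite_remainder_const:
  "integrable std_normal_distribution (\<lambda>x. (1 + \<bar>x\<bar>) * ((u + 2 * \<bar>x\<bar>)\<^sup>2 + u + \<bar>x\<bar>))"
proof -
  interpret N: real_distribution std_normal_distribution by (rule real_dist_normal_dist)
  have m: "integrable std_normal_distribution (\<lambda>x. c * \<bar>x\<bar> ^ k)" for c :: real and k
    using integrable_abs[OF integrable_std_normal_distribution_moment[of k]] by (simp add: power_abs)
  have "(\<lambda>x. (1 + \<bar>x\<bar>) * ((u + 2 * \<bar>x\<bar>)\<^sup>2 + u + \<bar>x\<bar>)) =
    (\<lambda>x. (u\<^sup>2 + u) * \<bar>x\<bar>^0 + (u\<^sup>2 + 5 * u + 1) * \<bar>x\<bar>^1 + (4 * u + 5) * \<bar>x\<bar>^2 + 4 * \<bar>x\<bar>^3 :: real)"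
    proof
    have "(1 + y) * ((u + 2 * y)\<^sup>2 + u + y) = (u\<^sup>2 + u) * y^0 + (u\<^sup>2 + 5 * u + 1) * y^1 + (4 * u + 5) * y^2 + 4 * y^3" for y :: real
      by (simp add: algebra_simps power2_eq_square power3_eq_cube)
    then show "(1 + \<bar>x\<bar>) * ((u + 2 * \<bar>x\<bar>)\<^sup>2 + u + \<bar>x\<bar>) = (u\<^sup>2 + u) * \<bar>x\<bar>^0 + (u\<^sup>2 + 5 * u + 1) * \<bar>x\<bar>^1 + (4 * u + 5) * \<bar>x\<bar>^2 + 4 * \<bar>x\<bar>^3" for x
      by blast
  qed
  then show ?thesis using m by (simp only: Bochner_Integration.integrable_add)
qed

lemma (in prob_space) integrable_mult_of_squares:
  fixes X Y :: "'a \<Rightarrow> real"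
  assumes [measurable]: "X \<in> borel_measurable M" "Y \<in> borel_measurable M"
    and sq: "integrable M (\<lambda>\<omega>. (X \<omega>)\<^sup>2)" "integrable M (\<lambda>\<omega>. (Y \<omega>)\<^sup>2)"
  shows "integrable M (\<lambda>\<omega>. X \<omega> * Y \<omega>)"
proof (rule Bochner_Integration.integrable_bound[OF Bochner_Integration.integrable_add[OF sq]])
  have "\<bar>x * y\<bar> \<le> x\<^sup>2 + y\<^sup>2" for x y :: real
  proof -
    have "2 * (\<bar>x\<bar> * \<bar>y\<bar>) \<le> x\<^sup>2 + y\<^sup>2" using sum_squares_bound[of "\<bar>x\<bar>" "\<bar>y\<bar>"] by simp
    moreover have "0 \<le> \<bar>x\<bar> * \<bar>y\<bar>" by simp
    ultimately show ?thesis unfolding abs_mult by linarith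
  qed
  then show "AE \<omega> in M. norm (X \<omega> * Y \<omega>) \<le> norm ((X \<omega>)\<^sup>2 + (Y \<omega>)\<^sup>2)" by auto
qed measurable

lemma (in prob_space) integrable_of_square:
  fixes X :: "'a \<Rightarrow> real"
  assumes "X \<in> borel_measurable M" "integrable M (\<lambda>\<omega>. (X \<omega>)\<^sup>2)"
  shows "integrable M X"
  using integrable_mult_of_squares[OF assms(1) _ assms(2), of "\<lambda>_. 1"] by simp

text \<open>Writing \<open>Y = \<rho> X + s W\<close> with \<open>W\<close> independent of \<open>X\<close> and integrating out \<open>W\<close> first, the
  second-order Taylor expansion of the distribution function leaves only terms of order \<open>\<rho>\<^sup>2\<close>.\<close>

lemma (in prob_space) hermite_remainder_covariance:
  fixes X Y :: "'a \<Rightarrow> real"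
  assumes X[measurable]: "X \<in> borel_measurable M" and Y[measurable]: "Y \<in> borel_measurable M"
    and gauss: "\<And>a b. gaussian_rv M (\<lambda>\<omega>. a * X \<omega> + b * Y \<omega>)"
    and mean: "expectation X = 0" "expectation Y = 0"
    and var: "expectation (\<lambda>\<omega>. (X \<omega>)\<^sup>2) = 1" "expectation (\<lambda>\<omega>. (Y \<omega>)\<^sup>2) = 1"
    and cov: "expectation (\<lambda>\<omega>. X \<omega> * Y \<omega>) = \<rho>"
    and \<rho>: "0 \<le> \<rho>" "\<rho> \<le> 1 / 2" and u: "u \<ge> 0"
  shows "\<bar>expectation (\<lambda>\<omega>. hermite_remainder u (X \<omega>) * hermite_remainder u (Y \<omega>))\<bar> \<le> \<rho>\<^sup>2 * hermite_remainder_const u"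
proof -
  interpret N: real_distribution std_normal_distribution by (rule real_dist_normal_dist)
  interpret NN: pair_sigma_finite std_normal_distribution std_normal_distribution ..
  define s where "s = sqrt (1 - \<rho>\<^sup>2)"
  have r2: "\<rho>\<^sup>2 \<le> 1/4" using power_mono[OF \<rho>(2,1), of 2] by (simp add: power2_eq_square)
  have s0: "s > 0" "s\<^sup>2 = 1 - \<rho>\<^sup>2" using r2 by (auto simp: s_def)
  \<comment> \<open>A nonintegrable function has Bochner integral 0, so a second moment equal to 1
    already forces integrability.\<close>
  have iX2: "integrable M (\<lambda>\<omega>. (X \<omega>)\<^sup>2)" and iY2: "integrable M (\<lambda>\<omega>. (Y \<omega>)\<^sup>2)"
    using var not_integrable_integral_eq by force+
  have iX: "integrable M X" and iY: "integrable M Y" and iXY: "integrable M (\<lambda>\<omega>. X \<omega> * Y \<omega>)"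
    using iX2 iY2 by (auto intro: integrable_of_square integrable_mult_of_squares)
  define W where "W = (\<lambda>\<omega>. (Y \<omega> - \<rho> * X \<omega>) / s)"
  have [measurable]: "W \<in> borel_measurable M" unfolding W_def by measurable
  have YW: "Y \<omega> = \<rho> * X \<omega> + s * W \<omega>" for \<omega> using s0 by (simp add: W_def)
  have law: "distr M (borel \<Otimes>\<^sub>M borel) (\<lambda>\<omega>. (X \<omega>, W \<omega>)) = std_normal_distribution \<Otimes>\<^sub>M std_normal_distribution"
  proof (rule joint_std_normal_law)
    fix a b :: real
    \<comment> \<open>Any combination of \<open>X\<close> and \<open>W\<close> is again one of
      \<open>X\<close> and \<open>Y\<close>, hence Gaussian by assumption, and \<open>s\<close> is
      chosen to make its variance \<open>a\<^sup>2 + b\<^sup>2\<close>.\<close>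
    define p q where "p = a - b * \<rho> / s" and "q = b / s"
    have lin: "a * X \<omega> + b * W \<omega> = p * X \<omega> + q * Y \<omega>" for \<omega>
      using s0 by (simp add: W_def p_def q_def field_simps)
    have m: "expectation (\<lambda>\<omega>. p * X \<omega> + q * Y \<omega>) = 0" using iX iY mean by simp
    have "expectation (\<lambda>\<omega>. (p * X \<omega> + q * Y \<omega>)\<^sup>2) = expectation (\<lambda>\<omega>. p\<^sup>2 * (X \<omega>)\<^sup>2 + q\<^sup>2 * (Y \<omega>)\<^sup>2 + 2 * p * q * (X \<omega> * Y \<omega>))"
      by (simp add: power2_sum power_mult_distrib mult_ac)
    also have "\<dots> = p\<^sup>2 + q\<^sup>2 + 2 * p * q * \<rho>" using iX2 iY2 iXY var cov by simp
    also have "\<dots> = (p + q * \<rho>)\<^sup>2 + q\<^sup>2 * (1 - \<rho>\<^sup>2)" by (simp add: power2_eq_square algebra_simps)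
    also have "\<dots> = a\<^sup>2 + b\<^sup>2" using s0(1) unfolding s0(2)[symmetric] by (simp add: p_def q_def power_divide)
    finally have v: "expectation (\<lambda>\<omega>. (p * X \<omega> + q * Y \<omega>)\<^sup>2) = a\<^sup>2 + b\<^sup>2" .
    show "expectation (\<lambda>\<omega>. iexp (a * X \<omega> + b * W \<omega>)) = exp (- (a\<^sup>2 + b\<^sup>2) / 2)"
      unfolding lin using gaussian_char_fun[OF gauss m] v by simp
  qed measurable
  let ?h = "hermite_remainder u"
  let ?f = "\<lambda>x w. ?h x * ?h (\<rho> * x + s * w)"
  have [measurable]: "case_prod ?f \<in> borel_measurable (borel \<Otimes>\<^sub>M borel)" by measurable
  have hint: "integrable M (\<lambda>\<omega>. (?h (V \<omega>))\<^sup>2)" if "integrable M (\<lambda>\<omega>. (V \<omega>)\<^sup>2)" and [measurable]: "V \<in> borel_measurable M" for V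
  proof (rule Bochner_Integration.integrable_bound)
    show "integrable M (\<lambda>\<omega>. 2 + 2 * (V \<omega>)\<^sup>2)" using that by simp
    have "norm ((?h v)\<^sup>2) \<le> norm (2 + 2 * v\<^sup>2)" for v
      using hermite_remainder_sq_le[of u v] by simp
    then show "AE \<omega> in M. norm ((?h (V \<omega>))\<^sup>2) \<le> norm (2 + 2 * (V \<omega>)\<^sup>2)" by simp
  qed measurable
  have iM: "integrable M (\<lambda>\<omega>. ?h (X \<omega>) * ?h (Y \<omega>))"
    using hint[OF iX2] hint[OF iY2] by (intro integrable_mult_of_squares) auto
  have i2: "integrable (std_normal_distribution \<Otimes>\<^sub>M std_normal_distribution) (case_prod ?f)"
    unfolding law[symmetric] using iM by (subst integrable_distr_eq) (simp_all add: YW)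
  have "expectation (\<lambda>\<omega>. ?h (X \<omega>) * ?h (Y \<omega>)) = integral\<^sup>L (std_normal_distribution \<Otimes>\<^sub>M std_normal_distribution) (case_prod ?f)"
    unfolding law[symmetric] by (subst integral_distr) (simp_all add: YW)
  also have "\<dots> = (LINT x|std_normal_distribution. LINT w|std_normal_distribution. ?f x w)"
    by (rule NN.integral_fst[OF i2, symmetric])
  finally have eq: "expectation (\<lambda>\<omega>. ?h (X \<omega>) * ?h (Y \<omega>)) = (LINT x|std_normal_distribution. LINT w|std_normal_distribution. ?f x w)" .
  \<comment> \<open>The absolute value is taken only after integrating over \<open>w\<close>, so
    that the cancellation in the inner integral survives.\<close>
  have "\<bar>LINT x|std_normal_distribution. LINT w|std_normal_distribution. ?f x w\<bar> \<le> (LINT x|std_normal_distribution. \<rho>\<^sup>2 * ((1 + \<bar>x\<bar>) * ((u + 2 * \<bar>x\<bar>)\<^sup>2 + u + \<bar>x\<bar>)))"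
  proof (rule order_trans[OF integral_abs_bound integral_mono])
    show "integrable std_normal_distribution (\<lambda>x. \<bar>LINT w|std_normal_distribution. ?f x w\<bar>)"
      using NN.integrable_fst[OF i2] by simp
    show "integrable std_normal_distribution (\<lambda>x. \<rho>\<^sup>2 * ((1 + \<bar>x\<bar>) * ((u + 2 * \<bar>x\<bar>)\<^sup>2 + u + \<bar>x\<bar>)))"
      using integrable_hermite_remainder_const by simp
    fix x
    have "\<bar>LINT w|std_normal_distribution. ?f x w\<bar> = \<bar>?h x\<bar> * \<bar>LINT w|std_normal_distribution. ?h (\<rho> * x + s * w)\<bar>"
      by (simp add: abs_mult)
    also have "\<dots> \<le> (1 + \<bar>x\<bar>) * (\<rho>\<^sup>2 * ((u + 2 * \<bar>x\<bar>)\<^sup>2 + u + \<bar>x\<bar>))"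
      by (intro mult_mono abs_hermite_remainder_le conditional_hermite_remainder_bound[OF \<rho> s_def u]) auto
    finally show "\<bar>LINT w|std_normal_distribution. ?f x w\<bar> \<le> \<rho>\<^sup>2 * ((1 + \<bar>x\<bar>) * ((u + 2 * \<bar>x\<bar>)\<^sup>2 + u + \<bar>x\<bar>))"
      by (simp add: mult_ac)
  qed
  also have "\<dots> = \<rho>\<^sup>2 * hermite_remainder_const u" by (simp add: hermite_remainder_const_def)
  finally show ?thesis unfolding eq .
qed

section \<open>Averages of random fields\<close>

lemma (in prob_space) expectation_Cauchy_Schwarz:
  fixes X Y :: "'a \<Rightarrow> real"
  assumes [measurable]: "X \<in> borel_measurable M" "Y \<in> borel_measurable M"
    and sq: "integrable M (\<lambda>\<omega>. (X \<omega>)\<^sup>2)" "integrable M (\<lambda>\<omega>. (Y \<omega>)\<^sup>2)"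
  shows "(expectation (\<lambda>\<omega>. X \<omega> * Y \<omega>))\<^sup>2 \<le> expectation (\<lambda>\<omega>. (X \<omega>)\<^sup>2) * expectation (\<lambda>\<omega>. (Y \<omega>)\<^sup>2)"
proof -
  define a b c where "a = expectation (\<lambda>\<omega>. (X \<omega>)\<^sup>2)" and "b = expectation (\<lambda>\<omega>. X \<omega> * Y \<omega>)"
    and "c = expectation (\<lambda>\<omega>. (Y \<omega>)\<^sup>2)"
  have iXY: "integrable M (\<lambda>\<omega>. X \<omega> * Y \<omega>)" by (rule integrable_mult_of_squares[OF _ _ sq]) auto
  have quad: "0 \<le> p\<^sup>2 * a + 2 * p * q * b + q\<^sup>2 * c" for p q
  proof -
    have "0 \<le> expectation (\<lambda>\<omega>. (p * X \<omega> + q * Y \<omega>)\<^sup>2)" by simp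
    also have "\<dots> = expectation (\<lambda>\<omega>. p\<^sup>2 * (X \<omega>)\<^sup>2 + 2 * p * q * (X \<omega> * Y \<omega>) + q\<^sup>2 * (Y \<omega>)\<^sup>2)"
      by (simp add: power2_sum power_mult_distrib algebra_simps)
    also have "\<dots> = p\<^sup>2 * a + 2 * p * q * b + q\<^sup>2 * c"
      using sq iXY by (simp add: a_def b_def c_def)
    finally show ?thesis .
  qed
  have nn: "0 \<le> a" "0 \<le> c" by (auto simp: a_def c_def)
  have "b\<^sup>2 \<le> a * c"
  proof (cases "c = 0")
    case True
    have "b = 0"
    proof (rule ccontr)
      assume "b \<noteq> 0"
      have "0 \<le> a + 2 * p * b" for p
        using quad[of 1 p] True by simp
      \<comment> \<open>This choice of \<open>p\<close> gives
        \<open>a + 2 * p * b = -1\<close>.\<close>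
      from this[of "- (a + 1) / (2 * b)"] \<open>b \<noteq> 0\<close> show False by (simp add: field_simps)
    qed
    then show ?thesis using nn by simp
  next
    case False
    then have "c > 0" using nn by simp
    \<comment> \<open>The quadratic form is evaluated at \<open>p = c\<close>,
      \<open>q = - b\<close>, the direction that minimises it for fixed \<open>p\<close>.\<close>
    have "0 \<le> c\<^sup>2 * a + 2 * c * (- b) * b + (- b)\<^sup>2 * c" by (rule quad)
    then have "0 \<le> c * (a * c - b\<^sup>2)" by (simp add: power2_eq_square algebra_simps)
    then show ?thesis using \<open>c > 0\<close> by (simp add: zero_le_mult_iff)
  qed
  then show ?thesis by (simp add: a_def b_def c_def)
qed

lemma (in prob_space) expectation_abs_le_sqrt:
  fixes X :: "'a \<Rightarrow> real"
  assumes [measurable]: "X \<in> borel_measurable M" and sq: "integrable M (\<lambda>\<omega>. (X \<omega>)\<^sup>2)"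
  shows "expectation (\<lambda>\<omega>. \<bar>X \<omega>\<bar>) \<le> sqrt (expectation (\<lambda>\<omega>. (X \<omega>)\<^sup>2))"
  using expectation_Cauchy_Schwarz[of "\<lambda>\<omega>. \<bar>X \<omega>\<bar>" "\<lambda>_. 1"] sq
  by (intro real_le_rsqrt) (auto simp: prob_space)

text \<open>\<open>iexp\<close> is 1-Lipschitz on the reals, so L2 closeness controls characteristic
  functions. The estimate serves twice: for replacing the average of the field by finite sums, and
  for discarding the remainder, where it takes the place of Slutsky's theorem.\<close>

lemma (in prob_space) char_fun_dist_le:
  fixes X Y :: "'a \<Rightarrow> real"
  assumes [measurable]: "X \<in> borel_measurable M" "Y \<in> borel_measurable M"
    and sq: "integrable M (\<lambda>\<omega>. (X \<omega> - Y \<omega>)\<^sup>2)"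
  shows "cmod (expectation (\<lambda>\<omega>. iexp (X \<omega>)) - expectation (\<lambda>\<omega>. iexp (Y \<omega>)))
    \<le> sqrt (expectation (\<lambda>\<omega>. (X \<omega> - Y \<omega>)\<^sup>2))"
proof -
  have int: "complex_integrable M (\<lambda>\<omega>. iexp (V \<omega>))" if [measurable]: "V \<in> borel_measurable M" for V
    by (intro integrable_const_bound[where B=1]) auto
  have ix: "cmod (iexp x - iexp y) \<le> \<bar>x - y\<bar>" for x y :: real
  proof -
    have "iexp x - iexp y = iexp y * (iexp (x - y) - 1)"
      by (simp add: ring_distribs exp_add[symmetric])
    then have "cmod (iexp x - iexp y) = cmod (iexp (x - y) - 1)"
      by (metis mult_1 norm_exp_i_times norm_mult)
    also have "\<dots> \<le> \<bar>x - y\<bar>" using iexp_approx1[of "x - y" 0] by simp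
    finally show ?thesis .
  qed
  have "expectation (\<lambda>\<omega>. iexp (X \<omega>)) - expectation (\<lambda>\<omega>. iexp (Y \<omega>)) = expectation (\<lambda>\<omega>. iexp (X \<omega>) - iexp (Y \<omega>))"
    by (intro Bochner_Integration.integral_diff[symmetric] int) auto
  also have "cmod \<dots> \<le> expectation (\<lambda>\<omega>. cmod (iexp (X \<omega>) - iexp (Y \<omega>)))"
    by (rule integral_norm_bound)
  also have "\<dots> \<le> expectation (\<lambda>\<omega>. \<bar>X \<omega> - Y \<omega>\<bar>)"
    using sq by (intro integral_mono integrable_norm Bochner_Integration.integrable_diff int ix integrable_abs
      integrable_of_square[where X="\<lambda>\<omega>. X \<omega> - Y \<omega>"]) auto
  also have "\<dots> \<le> sqrt (expectation (\<lambda>\<omega>. (X \<omega> - Y \<omega>)\<^sup>2))"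
    by (rule expectation_abs_le_sqrt) (use sq in auto)
  finally show ?thesis .
qed

text \<open>\<open>N\<close> is the law of a random sample point, so that a pathwise integral over a
  window becomes an average. The uniform bound \<open>B\<close> on the second moments is what the
  exchanges of integrals rest on.\<close>

locale averaged_field = prob_space M + N: prob_space N
  for M :: "'w measure" and N :: "'p measure" +
  fixes X :: "'p \<Rightarrow> 'w \<Rightarrow> real" and B :: real
  assumes field_measurable [measurable]: "case_prod X \<in> borel_measurable (N \<Otimes>\<^sub>M M)"
    and square_integrable: "\<And>p. p \<in> space N \<Longrightarrow> integrable M (\<lambda>\<omega>. (X p \<omega>)\<^sup>2)"
    and second_moment_le: "\<And>p. p \<in> space N \<Longrightarrow> expectation (\<lambda>\<omega>. (X p \<omega>)\<^sup>2) \<le> B"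
begin

definition average :: "'w \<Rightarrow> real" where
  "average \<omega> = (LINT p|N. X p \<omega>)"

sublocale NM: pair_prob_space N M ..
sublocale NN: pair_prob_space N N ..
sublocale NNM: pair_prob_space "N \<Otimes>\<^sub>M N" M ..

lemma measurable_component [measurable]: "p \<in> space N \<Longrightarrow> X p \<in> borel_measurable M"
  using measurable_compose[OF measurable_Pair1' field_measurable, of p] by simp

lemma average_measurable [measurable]: "average \<in> borel_measurable M"
  unfolding average_def[abs_def] by measurable

lemma integrable_mult_component:
  "p \<in> space N \<Longrightarrow> q \<in> space N \<Longrightarrow> integrable M (\<lambda>\<omega>. X p \<omega> * X q \<omega>)"
  by (intro integrable_mult_of_squares square_integrable) auto

lemma integrable_square_field: "integrable (N \<Otimes>\<^sub>M M) (\<lambda>(p, \<omega>). (X p \<omega>)\<^sup>2)"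
proof (rule NM.Fubini_integrable)
  show "integrable N (\<lambda>p. LINT \<omega>|M. norm (case (p, \<omega>) of (p, \<omega>) \<Rightarrow> (X p \<omega>)\<^sup>2))"
    using second_moment_le by (intro N.integrable_const_bound[where B=B]) (auto intro!: AE_I2)
qed (auto intro!: AE_I2 square_integrable)

lemma integrable_field: "integrable (N \<Otimes>\<^sub>M M) (case_prod X)"
proof -
  have "(\<lambda>(p, \<omega>). (X p \<omega>)\<^sup>2) = (\<lambda>z. (case_prod X z)\<^sup>2)" by auto
  then show ?thesis
    using NM.integrable_of_square[OF field_measurable] integrable_square_field by simp
qed

lemma AE_integrable_field: "AE \<omega> in M. integrable N (\<lambda>p. X p \<omega>)"
  by (rule NM.AE_integrable_snd[OF integrable_field])

lemma measurable_product_field [measurable]: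
  "(\<lambda>((p, q), \<omega>). X p \<omega> * X q \<omega>) \<in> borel_measurable ((N \<Otimes>\<^sub>M N) \<Otimes>\<^sub>M M)"
  unfolding case_prod_unfold by measurable

text \<open>The pairs of sample points form a probability space, so a constant bound on the absolute
  second moments is enough for Fubini; it comes from
  \<open>2 * \<bar>x * y\<bar> \<le> x\<^sup>2 + y\<^sup>2\<close>.\<close>

lemma integrable_product_field: "integrable ((N \<Otimes>\<^sub>M N) \<Otimes>\<^sub>M M) (\<lambda>((p, q), \<omega>). X p \<omega> * X q \<omega>)"
proof (rule NNM.Fubini_integrable)
  have "AE pq in N \<Otimes>\<^sub>M N. norm (LINT \<omega>|M. norm ((\<lambda>((p, q), \<omega>). X p \<omega> * X q \<omega>) (pq, \<omega>))) \<le> B"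
  proof (rule AE_I2)
    fix pq assume "pq \<in> space (N \<Otimes>\<^sub>M N)"
    then obtain p q where pq: "pq = (p, q)" "p \<in> space N" "q \<in> space N" by (auto simp: space_pair_measure)
    have "expectation (\<lambda>\<omega>. \<bar>X p \<omega> * X q \<omega>\<bar>) \<le> expectation (\<lambda>\<omega>. ((X p \<omega>)\<^sup>2 + (X q \<omega>)\<^sup>2) / 2)"
    proof (rule integral_mono)
      show "\<bar>X p \<omega> * X q \<omega>\<bar> \<le> ((X p \<omega>)\<^sup>2 + (X q \<omega>)\<^sup>2) / 2" for \<omega>
        using sum_squares_bound[of "\<bar>X p \<omega>\<bar>" "\<bar>X q \<omega>\<bar>"] by (simp add: abs_mult)
    qed (use pq integrable_mult_component square_integrable in auto)
    also have "\<dots> \<le> B" using pq square_integrable second_moment_le[of p] second_moment_le[of q] by simp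
    finally show "norm (LINT \<omega>|M. norm ((\<lambda>((p, q), \<omega>). X p \<omega> * X q \<omega>) (pq, \<omega>))) \<le> B"
      by (simp add: pq)
  qed
  then show "integrable (N \<Otimes>\<^sub>M N) (\<lambda>pq. LINT \<omega>|M. norm ((\<lambda>((p, q), \<omega>). X p \<omega> * X q \<omega>) (pq, \<omega>)))"
    unfolding case_prod_unfold fst_conv snd_conv by (intro NN.integrable_const_bound[where B=B]) measurable
qed (auto intro!: AE_I2 integrable_mult_component simp: space_pair_measure)

text \<open>The square of an integral is rewritten as a double integral on those paths whose product
  is integrable over pairs; by Fubini almost all paths are of this kind.\<close>

lemma average_square_AE:
  "AE \<omega> in M. (LINT (p, q)|(N \<Otimes>\<^sub>M N). X p \<omega> * X q \<omega>) = (average \<omega>)\<^sup>2"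
proof -
  have "AE \<omega> in M. integrable (N \<Otimes>\<^sub>M N) (\<lambda>(p, q). X p \<omega> * X q \<omega>)"
    using NNM.AE_integrable_snd[of "\<lambda>(p, q) \<omega>. X p \<omega> * X q \<omega>"] integrable_product_field
    by (simp add: split_beta')
  then show ?thesis
  proof eventually_elim
  case (elim \<omega>)
  then have "(LINT p|N. LINT q|N. X p \<omega> * X q \<omega>) = (LINT (p, q)|(N \<Otimes>\<^sub>M N). X p \<omega> * X q \<omega>)"
    by (intro NN.integral_fst) auto
  then show ?case by (simp add: average_def power2_eq_square)
  qed
qed

lemma integrable_average_square: "integrable M (\<lambda>\<omega>. (average \<omega>)\<^sup>2)"
proof -
  have "integrable M (\<lambda>\<omega>. LINT (p, q)|(N \<Otimes>\<^sub>M N). X p \<omega> * X q \<omega>)"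
    using NNM.integrable_snd[of "\<lambda>(p, q) \<omega>. X p \<omega> * X q \<omega>"] integrable_product_field by (simp add: split_beta')
  then show ?thesis
    by (rule integrable_cong_AE_imp) (use average_square_AE in auto)
qed

lemma integrable_covariance: "integrable (N \<Otimes>\<^sub>M N) (\<lambda>(p, q). expectation (\<lambda>\<omega>. X p \<omega> * X q \<omega>))"
  using NNM.integrable_fst[of "\<lambda>(p, q) \<omega>. X p \<omega> * X q \<omega>"] integrable_product_field by (simp add: split_beta')

lemma expectation_average_square:
  "expectation (\<lambda>\<omega>. (average \<omega>)\<^sup>2) = (LINT (p, q)|(N \<Otimes>\<^sub>M N). expectation (\<lambda>\<omega>. X p \<omega> * X q \<omega>))"
proof -
  have "expectation (\<lambda>\<omega>. (average \<omega>)\<^sup>2) = expectation (\<lambda>\<omega>. LINT (p, q)|(N \<Otimes>\<^sub>M N). X p \<omega> * X q \<omega>)"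
    using average_square_AE by (intro integral_cong_AE) auto
  also have "\<dots> = (LINT (p, q)|(N \<Otimes>\<^sub>M N). expectation (\<lambda>\<omega>. X p \<omega> * X q \<omega>))"
    using NNM.Fubini_integral[of "\<lambda>(p, q) \<omega>. X p \<omega> * X q \<omega>"] integrable_product_field by (simp add: split_beta')
  finally show ?thesis .
qed

text \<open>Jensen's inequality, read off from the nonnegativity of the variance of a path under
  \<open>N\<close>.\<close>

lemma expectation_average_square_le:
  "expectation (\<lambda>\<omega>. (average \<omega>)\<^sup>2) \<le> (LINT p|N. expectation (\<lambda>\<omega>. (X p \<omega>)\<^sup>2))"
proof -
  have i: "integrable N (\<lambda>p. expectation (\<lambda>\<omega>. (X p \<omega>)\<^sup>2))"
    using NM.integrable_fst[of "\<lambda>p \<omega>. (X p \<omega>)\<^sup>2"] integrable_square_field by simp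
  have "(average \<omega>)\<^sup>2 \<le> (LINT p|N. (X p \<omega>)\<^sup>2)" if "integrable N (\<lambda>p. X p \<omega>)" "integrable N (\<lambda>p. (X p \<omega>)\<^sup>2)" for \<omega>
    using N.variance_positive[of "\<lambda>p. X p \<omega>"] N.variance_eq[OF that] by (simp add: average_def)
  moreover have "AE \<omega> in M. integrable N (\<lambda>p. (X p \<omega>)\<^sup>2)"
    by (rule NM.AE_integrable_snd[OF integrable_square_field])
  ultimately have "AE \<omega> in M. (average \<omega>)\<^sup>2 \<le> (LINT p|N. (X p \<omega>)\<^sup>2)"
    using AE_integrable_field by auto
  then have "expectation (\<lambda>\<omega>. (average \<omega>)\<^sup>2) \<le> expectation (\<lambda>\<omega>. LINT p|N. (X p \<omega>)\<^sup>2)"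
    using NM.integrable_snd[of "\<lambda>p \<omega>. (X p \<omega>)\<^sup>2"] integrable_square_field integrable_average_square
    by (intro integral_mono_AE) auto
  also have "\<dots> = (LINT p|N. expectation (\<lambda>\<omega>. (X p \<omega>)\<^sup>2))"
    using NM.Fubini_integral[of "\<lambda>p \<omega>. (X p \<omega>)\<^sup>2"] integrable_square_field by simp
  finally show ?thesis .
qed

lemma expectation_average: "expectation average = (LINT p|N. expectation (X p))"
  unfolding average_def[abs_def] using NM.Fubini_integral[of X] integrable_field by simp

end

lemma (in averaged_field) expectation_average_square_bound:
  "expectation (\<lambda>\<omega>. (average \<omega>)\<^sup>2) \<le> B"
proof -
  have "integrable N (\<lambda>p. expectation (\<lambda>\<omega>. (X p \<omega>)\<^sup>2))"
    using NM.integrable_fst[of "\<lambda>p \<omega>. (X p \<omega>)\<^sup>2"] integrable_square_field by simp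
  then have "(LINT p|N. expectation (\<lambda>\<omega>. (X p \<omega>)\<^sup>2)) \<le> (LINT p|N. B)"
    using second_moment_le by (intro integral_mono) auto
  then show ?thesis using expectation_average_square_le by (simp add: N.prob_space)
qed

text \<open>Meant for a discretisation \<open>F\<close> of the sample points: moving the points
  keeps the moment bound, since that bound is uniform in \<open>p\<close>.\<close>

lemma (in averaged_field) averaged_field_comp:
  assumes [measurable]: "F \<in> measurable N N"
  shows "averaged_field M N (\<lambda>p. X (F p)) B"
proof
  show "(\<lambda>(p, \<omega>). X (F p) \<omega>) \<in> borel_measurable (N \<Otimes>\<^sub>M M)"
    unfolding case_prod_unfold by measurable
qed (use measurable_space[OF assms] in \<open>auto intro!: square_integrable second_moment_le\<close>)

lemma (in prob_space) square_integrable_diff: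
  fixes X Y :: "'a \<Rightarrow> real"
  assumes [measurable]: "X \<in> borel_measurable M" "Y \<in> borel_measurable M"
    and sq: "integrable M (\<lambda>\<omega>. (X \<omega>)\<^sup>2)" "integrable M (\<lambda>\<omega>. (Y \<omega>)\<^sup>2)"
  shows "integrable M (\<lambda>\<omega>. (X \<omega> - Y \<omega>)\<^sup>2)" (is ?I)
    and "expectation (\<lambda>\<omega>. (X \<omega> - Y \<omega>)\<^sup>2) \<le> 2 * expectation (\<lambda>\<omega>. (X \<omega>)\<^sup>2) + 2 * expectation (\<lambda>\<omega>. (Y \<omega>)\<^sup>2)"
proof -
  have le: "(x - y)\<^sup>2 \<le> 2 * x\<^sup>2 + 2 * y\<^sup>2" for x y :: real
    using zero_le_power2[of "x + y"] by (simp add: power2_sum power2_diff)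
  have i: "integrable M (\<lambda>\<omega>. 2 * (X \<omega>)\<^sup>2 + 2 * (Y \<omega>)\<^sup>2)" using sq by simp
  show ?I by (rule Bochner_Integration.integrable_bound[OF i]) (use le in auto)
  then have "expectation (\<lambda>\<omega>. (X \<omega> - Y \<omega>)\<^sup>2) \<le> expectation (\<lambda>\<omega>. 2 * (X \<omega>)\<^sup>2 + 2 * (Y \<omega>)\<^sup>2)"
    using le by (intro integral_mono i) auto
  then show "expectation (\<lambda>\<omega>. (X \<omega> - Y \<omega>)\<^sup>2) \<le> 2 * expectation (\<lambda>\<omega>. (X \<omega>)\<^sup>2) + 2 * expectation (\<lambda>\<omega>. (Y \<omega>)\<^sup>2)"
    using sq by simp
qed

text \<open>The factor 4 stems from
  \<open>(x - y)\<^sup>2 \<le> 2 * x\<^sup>2 + 2 * y\<^sup>2\<close>. Linearity of the average is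
  obtained on paths where both fields are integrable, hence almost everywhere.\<close>

lemma averaged_field_diff:
  assumes "averaged_field M N X B" "averaged_field M N Y B"
  shows "averaged_field M N (\<lambda>p \<omega>. X p \<omega> - Y p \<omega>) (4 * B)"
    and "AE \<omega> in M. averaged_field.average N (\<lambda>p \<omega>. X p \<omega> - Y p \<omega>) \<omega>
      = averaged_field.average N X \<omega> - averaged_field.average N Y \<omega>"
proof -
  interpret X: averaged_field M N X B by fact
  interpret Y: averaged_field M N Y B by fact
  show D: "averaged_field M N (\<lambda>p \<omega>. X p \<omega> - Y p \<omega>) (4 * B)"
  proof
    show "(\<lambda>(p, \<omega>). X p \<omega> - Y p \<omega>) \<in> borel_measurable (N \<Otimes>\<^sub>M M)" by measurable
    fix p assume p: "p \<in> space N"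
    show "integrable M (\<lambda>\<omega>. (X p \<omega> - Y p \<omega>)\<^sup>2)"
      using p by (intro X.square_integrable_diff X.square_integrable Y.square_integrable) auto
    have "X.expectation (\<lambda>\<omega>. (X p \<omega> - Y p \<omega>)\<^sup>2) \<le> 2 * X.expectation (\<lambda>\<omega>. (X p \<omega>)\<^sup>2) + 2 * X.expectation (\<lambda>\<omega>. (Y p \<omega>)\<^sup>2)"
      using p by (intro X.square_integrable_diff X.square_integrable Y.square_integrable) auto
    then show "X.expectation (\<lambda>\<omega>. (X p \<omega> - Y p \<omega>)\<^sup>2) \<le> 4 * B"
      using X.second_moment_le[OF p] Y.second_moment_le[OF p] by linarith
  qed
  interpret D: averaged_field M N "\<lambda>p \<omega>. X p \<omega> - Y p \<omega>" "4 * B" by fact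
  show "AE \<omega> in M. D.average \<omega> = X.average \<omega> - Y.average \<omega>"
    using X.AE_integrable_field Y.AE_integrable_field
    by eventually_elim (simp add: X.average_def Y.average_def D.average_def)
qed

text \<open>Simple functions \<open>F i\<close> converging pointwise to the identity turn the average into finite Gaussian sums;
  mean-square continuity gives convergence in \<open>L\<^sup>2\<close>.\<close>

lemma gaussian_average_char:
  fixes N :: "'p::{metric_space, second_countable_topology} measure" and X :: "'p \<Rightarrow> 'w \<Rightarrow> real"
  assumes field: "averaged_field M N X B" and N: "sets N = sets borel"
    and gauss: "\<And>S a. finite S \<Longrightarrow> gaussian_rv M (\<lambda>\<omega>. \<Sum>p\<in>S. a p * X p \<omega>)"
    and mean: "\<And>p. prob_space.expectation M (X p) = 0"
    and cont: "\<And>p. ((\<lambda>q. prob_space.expectation M (\<lambda>\<omega>. (X q \<omega> - X p \<omega>)\<^sup>2)) \<longlongrightarrow> 0) (at p)"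
  defines "A \<equiv> averaged_field.average N X"
  shows "prob_space.expectation M (\<lambda>\<omega>. iexp (\<theta> * A \<omega>)) =
    exp (- (\<theta>\<^sup>2 * prob_space.expectation M (\<lambda>\<omega>. (A \<omega>)\<^sup>2)) / 2)"
proof -
  interpret X: averaged_field M N X B by fact
  have spN: "space N = UNIV" using sets_eq_imp_space_eq[OF N] by simp
  have idN: "id \<in> borel_measurable N" using N by (auto simp: measurable_def spN)
  \<comment> \<open>Second countability supplies simple approximations of the identity;
    \<open>undefined\<close> is an arbitrary reference point.\<close>
  obtain F where F: "\<And>i. simple_function N (F i)" "\<And>p. (\<lambda>i. F i p) \<longlonglongrightarrow> p"
    using borel_measurable_implies_sequence_metric[OF idN, of undefined] by (auto simp: spN)
  have Fm: "F i \<in> measurable N N" for i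
    using borel_measurable_simple_function[OF F(1)[of i]] measurable_cong_sets[OF refl N] by blast
  define S where "S i = averaged_field.average N (\<lambda>p. X (F i p))" for i
  have S: "averaged_field M N (\<lambda>p. X (F i p)) B" for i by (rule X.averaged_field_comp[OF Fm])
  have A_meas [measurable]: "A \<in> borel_measurable M" unfolding A_def by (rule X.average_measurable)
  have S_meas [measurable]: "S i \<in> borel_measurable M" for i unfolding S_def by (rule averaged_field.average_measurable[OF S])
  have A2: "integrable M (\<lambda>\<omega>. (A \<omega>)\<^sup>2)" unfolding A_def by (rule X.integrable_average_square)
  have S2: "integrable M (\<lambda>\<omega>. (S i \<omega>)\<^sup>2)" for i unfolding S_def by (rule averaged_field.integrable_average_square[OF S])
  have EA: "X.expectation (\<lambda>\<omega>. (A \<omega>)\<^sup>2) \<le> B" unfolding A_def by (rule X.expectation_average_square_bound)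
  have ES: "X.expectation (\<lambda>\<omega>. (S i \<omega>)\<^sup>2) \<le> B" for i unfolding S_def by (rule averaged_field.expectation_average_square_bound[OF S])
  define d where "d i = X.expectation (\<lambda>\<omega>. (A \<omega> - S i \<omega>)\<^sup>2)" for i
  have iD: "integrable M (\<lambda>\<omega>. (A \<omega> - S i \<omega>)\<^sup>2)" for i
    using A2 S2 by (intro X.square_integrable_diff) auto
  define e where "e i p = X.expectation (\<lambda>\<omega>. (X p \<omega> - X (F i p) \<omega>)\<^sup>2)" for i p
  \<comment> \<open>Jensen's inequality reduces the L2 distance of the averages to the mean-square
    distance of the fields at single points.\<close>
  have de: "d i \<le> (LINT p|N. e i p)" for i
  proof -
    interpret D: averaged_field M N "\<lambda>p \<omega>. X p \<omega> - X (F i p) \<omega>" "4 * B"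
      by (rule averaged_field_diff(1)[OF field S])
    have "d i = X.expectation (\<lambda>\<omega>. (D.average \<omega>)\<^sup>2)"
      unfolding d_def using averaged_field_diff(2)[OF field S, of i]
      unfolding A_def[symmetric] S_def[symmetric] by (intro integral_cong_AE) auto
    then show ?thesis using D.expectation_average_square_le by (simp add: e_def)
  qed
  have "(\<lambda>i. LINT p|N. e i p) \<longlonglongrightarrow> (LINT p|N. 0)"
  proof (rule integral_dominated_convergence)
    show "e i \<in> borel_measurable N" for i
    proof -
      interpret D: averaged_field M N "\<lambda>p \<omega>. X p \<omega> - X (F i p) \<omega>" "4 * B"
        by (rule averaged_field_diff(1)[OF field S])
      show ?thesis unfolding e_def[abs_def]
        using X.NM.integrable_fst[of "\<lambda>p \<omega>. (X p \<omega> - X (F i p) \<omega>)\<^sup>2"] D.integrable_square_field by auto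
    qed
    show "AE p in N. norm (e i p) \<le> 4 * B" for i
    proof (rule AE_I2)
      fix p assume p: "p \<in> space N"
      interpret D: averaged_field M N "\<lambda>p \<omega>. X p \<omega> - X (F i p) \<omega>" "4 * B"
        by (rule averaged_field_diff(1)[OF field S])
      show "norm (e i p) \<le> 4 * B" using D.second_moment_le[OF p] by (simp add: e_def)
    qed
    show "AE p in N. (\<lambda>i. e i p) \<longlonglongrightarrow> 0"
    proof (rule AE_I2)
      fix p
      define g where "g q = X.expectation (\<lambda>\<omega>. (X q \<omega> - X p \<omega>)\<^sup>2)" for q
      \<comment> \<open>Mean-square continuity is a limit at \<open>p\<close> with \<open>p\<close>
        itself excluded, but \<open>F i p\<close> may equal \<open>p\<close>; the value 0 there
        fills the gap.\<close>
      have "g p = 0" by (simp add: g_def)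
      then have "(g \<longlongrightarrow> 0) (nhds p)"
        using cont[of p] tendsto_at_iff_tendsto_nhds[of g p] by (simp add: g_def[abs_def])
      then have "(\<lambda>i. g (F i p)) \<longlonglongrightarrow> 0" by (rule filterlim_compose[OF _ F(2)])
      moreover have "g (F i p) = e i p" for i
        by (simp add: g_def e_def power2_commute)
      ultimately show "(\<lambda>i. e i p) \<longlonglongrightarrow> 0" by simp
    qed
  qed auto
  then have e0: "(\<lambda>i. LINT p|N. e i p) \<longlonglongrightarrow> 0" by simp
  have d0: "d \<longlonglongrightarrow> 0"
    by (rule tendsto_sandwich[OF _ _ tendsto_const e0]) (use de in \<open>auto simp: d_def\<close>)
  have S_char: "X.expectation (\<lambda>\<omega>. iexp (\<theta> * S i \<omega>)) = exp (- (\<theta>\<^sup>2 * X.expectation (\<lambda>\<omega>. (S i \<omega>)\<^sup>2)) / 2)" for i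
  proof -
    let ?R = "F i ` space N" and ?c = "\<lambda>q. measure N (F i -` {q} \<inter> space N)"
    have fin: "finite ?R" using F(1)[of i] by (rule simple_functionD)
    have sets: "F i -` {q} \<inter> space N \<in> sets N" for q using F(1)[of i] by (rule simple_functionD)
    \<comment> \<open>After discretisation only finitely many points of the field occur, so the
      average is a finite sum weighted by the masses of the level sets of
      \<open>F i\<close>.\<close>
    have S_eq: "S i \<omega> = (\<Sum>q\<in>?R. ?c q * X q \<omega>)" for \<omega>
    proof -
      have "X (F i p) \<omega> = (\<Sum>q\<in>?R. indicator (F i -` {q} \<inter> space N) p * X q \<omega>)" for p
        using fin by (subst sum.remove[of _ "F i p"]) (auto simp: spN intro!: sum.neutral)
      then have "S i \<omega> = (LINT p|N. (\<Sum>q\<in>?R. indicator (F i -` {q} \<inter> space N) p * X q \<omega>))"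
        by (simp add: S_def averaged_field.average_def[OF S])
      also have "\<dots> = (\<Sum>q\<in>?R. ?c q * X q \<omega>)"
        using sets by (subst Bochner_Integration.integral_sum) (auto simp: X.N.emeasure_eq_measure)
      finally show ?thesis .
    qed
    have g: "gaussian_rv M (\<lambda>\<omega>. \<theta> * S i \<omega>)"
      using gauss[OF fin, of "\<lambda>q. \<theta> * ?c q"] by (simp add: S_eq sum_distrib_left mult.assoc)
    have ix: "integrable M (X q)" for q
      by (rule X.integrable_of_square) (auto simp: spN intro!: X.square_integrable)
    have "X.expectation (\<lambda>\<omega>. \<theta> * S i \<omega>) = 0"
      using ix mean by (simp add: S_eq)
    from X.gaussian_char_fun[OF g this] show ?thesis by (simp add: power_mult_distrib)
  qed
  \<comment> \<open>The difference of squares is factored; by Cauchy-Schwarz one factor tends to 0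
    in L2 while the other has second moment at most \<open>4 * B\<close>.\<close>
  have ES_lim: "(\<lambda>i. X.expectation (\<lambda>\<omega>. (S i \<omega>)\<^sup>2)) \<longlonglongrightarrow> X.expectation (\<lambda>\<omega>. (A \<omega>)\<^sup>2)"
  proof (rule LIM_zero_cancel, rule tendsto_rabs_zero_cancel, rule tendsto_sandwich[OF _ _ tendsto_const])
    show "(\<lambda>i. sqrt (d i * (4 * B))) \<longlonglongrightarrow> 0"
      using tendsto_real_sqrt[OF tendsto_mult_left_zero[OF d0, of "4 * B"]] by simp
    show "\<forall>\<^sub>F i in sequentially. \<bar>X.expectation (\<lambda>\<omega>. (S i \<omega>)\<^sup>2) - X.expectation (\<lambda>\<omega>. (A \<omega>)\<^sup>2)\<bar> \<le> sqrt (d i * (4 * B))"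
    proof (rule always_eventually, rule allI)
      fix i
      have s: "integrable M (\<lambda>\<omega>. (A \<omega> + S i \<omega>)\<^sup>2)" "X.expectation (\<lambda>\<omega>. (A \<omega> + S i \<omega>)\<^sup>2) \<le> 4 * B"
        using X.square_integrable_diff[of A "\<lambda>\<omega>. - S i \<omega>"] A2 S2[of i] EA ES[of i] by auto
      have "X.expectation (\<lambda>\<omega>. (A \<omega>)\<^sup>2) - X.expectation (\<lambda>\<omega>. (S i \<omega>)\<^sup>2) = X.expectation (\<lambda>\<omega>. (A \<omega> - S i \<omega>) * (A \<omega> + S i \<omega>))"
      proof -
        have "(A \<omega> - S i \<omega>) * (A \<omega> + S i \<omega>) = (A \<omega>)\<^sup>2 - (S i \<omega>)\<^sup>2" for \<omega>
          by (simp add: power2_eq_square algebra_simps)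
        then show ?thesis using A2 S2[of i] by simp
      qed
      moreover have "\<bar>X.expectation (\<lambda>\<omega>. (A \<omega> - S i \<omega>) * (A \<omega> + S i \<omega>))\<bar> \<le> sqrt (d i * X.expectation (\<lambda>\<omega>. (A \<omega> + S i \<omega>)\<^sup>2))"
        using X.expectation_Cauchy_Schwarz[OF _ _ iD s(1)] by (intro real_le_rsqrt) (auto simp: d_def)
      moreover have "\<dots> \<le> sqrt (d i * (4 * B))"
        using s(2) by (intro real_sqrt_le_mono mult_left_mono) (auto simp: d_def)
      ultimately show "\<bar>X.expectation (\<lambda>\<omega>. (S i \<omega>)\<^sup>2) - X.expectation (\<lambda>\<omega>. (A \<omega>)\<^sup>2)\<bar> \<le> sqrt (d i * (4 * B))"
        by linarith
    qed
  qed auto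
  have lim1: "(\<lambda>i. X.expectation (\<lambda>\<omega>. iexp (\<theta> * S i \<omega>))) \<longlonglongrightarrow> exp (- (\<theta>\<^sup>2 * X.expectation (\<lambda>\<omega>. (A \<omega>)\<^sup>2)) / 2)"
    unfolding S_char by (intro tendsto_intros ES_lim) auto
  have lim2: "(\<lambda>i. X.expectation (\<lambda>\<omega>. iexp (\<theta> * S i \<omega>))) \<longlonglongrightarrow> X.expectation (\<lambda>\<omega>. iexp (\<theta> * A \<omega>))"
  proof (rule LIM_zero_cancel, rule tendsto_norm_zero_cancel, rule tendsto_sandwich[OF _ _ tendsto_const])
    show "(\<lambda>i. sqrt (\<theta>\<^sup>2 * d i)) \<longlonglongrightarrow> 0"
      using tendsto_real_sqrt[OF tendsto_mult_right_zero[OF d0, of "\<theta>\<^sup>2"]] by simp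
    show "\<forall>\<^sub>F i in sequentially. cmod (X.expectation (\<lambda>\<omega>. iexp (\<theta> * S i \<omega>)) - X.expectation (\<lambda>\<omega>. iexp (\<theta> * A \<omega>))) \<le> sqrt (\<theta>\<^sup>2 * d i)"
    proof (rule always_eventually, rule allI)
      fix i
      have sq: "(\<theta> * S i \<omega> - \<theta> * A \<omega>)\<^sup>2 = \<theta>\<^sup>2 * (A \<omega> - S i \<omega>)\<^sup>2" for \<omega>
        by (simp add: right_diff_distrib[symmetric] power_mult_distrib power2_commute)
      have "cmod (X.expectation (\<lambda>\<omega>. iexp (\<theta> * S i \<omega>)) - X.expectation (\<lambda>\<omega>. iexp (\<theta> * A \<omega>)))
        \<le> sqrt (X.expectation (\<lambda>\<omega>. (\<theta> * S i \<omega> - \<theta> * A \<omega>)\<^sup>2))"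
        by (rule X.char_fun_dist_le) (use iD in \<open>auto simp: sq\<close>)
      then show "cmod (X.expectation (\<lambda>\<omega>. iexp (\<theta> * S i \<omega>)) - X.expectation (\<lambda>\<omega>. iexp (\<theta> * A \<omega>))) \<le> sqrt (\<theta>\<^sup>2 * d i)"
        unfolding sq by (simp add: d_def)
    qed
  qed auto
  show ?thesis by (rule LIMSEQ_unique[OF lim2 lim1])
qed

section \<open>Uniform sampling of distances\<close>

lemma nn_integral_abs_eq:
  fixes f :: "real \<Rightarrow> ennreal"
  assumes [measurable]: "f \<in> borel_measurable borel"
  shows "(\<integral>\<^sup>+r. f \<bar>r\<bar> \<partial>lborel) = 2 * (\<integral>\<^sup>+r. f r * indicator {0..} r \<partial>lborel)"
proof -
  have "(\<integral>\<^sup>+r. f \<bar>r\<bar> \<partial>lborel) = (\<integral>\<^sup>+r. f \<bar>r\<bar> * indicator {0..} r + f \<bar>r\<bar> * indicator {..0} r \<partial>lborel)"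
    using AE_lborel_singleton[of "0::real"] by (intro nn_integral_cong_AE) (auto split: split_indicator)
  also have "\<dots> = (\<integral>\<^sup>+r. f \<bar>r\<bar> * indicator {0..} r \<partial>lborel) + (\<integral>\<^sup>+r. f \<bar>r\<bar> * indicator {..0} r \<partial>lborel)"
    by (rule nn_integral_add) auto
  also have "(\<integral>\<^sup>+r. f \<bar>r\<bar> * indicator {..0} r \<partial>lborel) = (\<integral>\<^sup>+r. f \<bar>- r\<bar> * indicator {..0} (- r) \<partial>lborel)"
    using nn_integral_real_affine[of "\<lambda>r. f \<bar>r\<bar> * indicator {..0} r" "-1" 0] by simp
  also have "\<dots> = (\<integral>\<^sup>+r. f r * indicator {0..} r \<partial>lborel)"
    by (intro nn_integral_cong) (auto split: split_indicator)
  also have "(\<integral>\<^sup>+r. f \<bar>r\<bar> * indicator {0..} r \<partial>lborel) = (\<integral>\<^sup>+r. f r * indicator {0..} r \<partial>lborel)"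
    by (intro nn_integral_cong) (auto split: split_indicator)
  finally show ?thesis by (simp add: mult_2)
qed

text \<open>Source of the weight \<open>1 - \<tau> / T\<close> in the normalisation: after
  substituting \<open>s = t + r\<close>, the times \<open>t\<close> with both \<open>t\<close> and
  \<open>t + r\<close> in the window form an interval of length \<open>T - \<bar>r\<bar>\<close>.
  The factor 2 merges the two signs of \<open>r\<close>, and \<open>ennreal\<close> truncates to 0
  beyond \<open>T\<close>.\<close>

lemma nn_integral_time_difference:
  fixes g :: "real \<Rightarrow> ennreal" and T :: real
  assumes [measurable]: "g \<in> borel_measurable borel" and T: "T > 0"
  shows "(\<integral>\<^sup>+t\<in>{0..T}. (\<integral>\<^sup>+s\<in>{0..T}. g \<bar>t - s\<bar> \<partial>lborel) \<partial>lborel) =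
    2 * (\<integral>\<^sup>+\<tau>\<in>{0..T}. ennreal (T - \<tau>) * g \<tau> \<partial>lborel)"
proof -
  have "(\<integral>\<^sup>+t\<in>{0..T}. (\<integral>\<^sup>+s\<in>{0..T}. g \<bar>t - s\<bar> \<partial>lborel) \<partial>lborel) =
      (\<integral>\<^sup>+t. (\<integral>\<^sup>+r. g \<bar>r\<bar> * (indicator {0..T} t * indicator {0..T} (t + r)) \<partial>lborel) \<partial>lborel)"
  proof (rule nn_integral_cong)
    fix t :: real
    have "(\<integral>\<^sup>+s\<in>{0..T}. g \<bar>t - s\<bar> \<partial>lborel) = (\<integral>\<^sup>+r. g \<bar>r\<bar> * indicator {0..T} (t + r) \<partial>lborel)"
      using nn_integral_real_affine[of "\<lambda>s. g \<bar>t - s\<bar> * indicator {0..T} s" 1 t] by simp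
    moreover have "(\<integral>\<^sup>+r. g \<bar>r\<bar> * indicator {0..T} (t + r) \<partial>lborel) * indicator {0..T} t
        = (\<integral>\<^sup>+r. g \<bar>r\<bar> * (indicator {0..T} t * indicator {0..T} (t + r)) \<partial>lborel)"
      by (subst nn_integral_multc[symmetric]) (auto intro!: nn_integral_cong simp: mult_ac)
    ultimately show "(\<integral>\<^sup>+s\<in>{0..T}. g \<bar>t - s\<bar> \<partial>lborel) * indicator {0..T} t =
        (\<integral>\<^sup>+r. g \<bar>r\<bar> * (indicator {0..T} t * indicator {0..T} (t + r)) \<partial>lborel)"
      by simp
  qed
  also have "\<dots> = (\<integral>\<^sup>+r. (\<integral>\<^sup>+t. g \<bar>r\<bar> * (indicator {0..T} t * indicator {0..T} (t + r)) \<partial>lborel) \<partial>lborel)"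
    by (rule lborel_pair.Fubini') measurable
  also have "\<dots> = (\<integral>\<^sup>+r. g \<bar>r\<bar> * ennreal (T - \<bar>r\<bar>) \<partial>lborel)"
  proof (rule nn_integral_cong)
    fix r :: real
    have "(\<integral>\<^sup>+t. g \<bar>r\<bar> * (indicator {0..T} t * indicator {0..T} (t + r)) \<partial>lborel)
        = g \<bar>r\<bar> * (\<integral>\<^sup>+t. indicator {max 0 (- r) .. min T (T - r)} t \<partial>lborel)"
      by (subst nn_integral_cmult[symmetric]) (auto intro!: nn_integral_cong split: split_indicator)
    also have "(\<integral>\<^sup>+t. indicator {max 0 (- r) .. min T (T - r)} t \<partial>lborel) = ennreal (T - \<bar>r\<bar>)"
      by (auto simp: emeasure_lborel_Icc_eq max_def min_def ennreal_neg)
    finally show "(\<integral>\<^sup>+t. g \<bar>r\<bar> * (indicator {0..T} t * indicator {0..T} (t + r)) \<partial>lborel) = g \<bar>r\<bar> * ennreal (T - \<bar>r\<bar>)" .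
  qed
  also have "\<dots> = 2 * (\<integral>\<^sup>+r. g r * ennreal (T - r) * indicator {0..} r \<partial>lborel)"
    by (rule nn_integral_abs_eq[of "\<lambda>r. g r * ennreal (T - r)"]) measurable
  also have "(\<integral>\<^sup>+r. g r * ennreal (T - r) * indicator {0..} r \<partial>lborel) = (\<integral>\<^sup>+\<tau>\<in>{0..T}. ennreal (T - \<tau>) * g \<tau> \<partial>lborel)"
    by (intro nn_integral_cong) (auto split: split_indicator simp: mult.commute ennreal_neg)
  finally show ?thesis .
qed

text \<open>Almost every \<open>r \<in> {1..2}\<close> scales the set in question onto a null set, because every ray meets it in
  a null set; scaling back by one such \<open>r\<close> shows that the set itself is null.\<close>

lemma norm_vimage_null_set:
  assumes N: "N \<in> null_sets (lborel :: real measure)"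
  shows "{x::'a::euclidean_space. norm x \<in> N} \<in> null_sets lborel"
proof -
  define E where "E = {x::'a. norm x \<in> N}"
  have [measurable]: "N \<in> sets borel" using N by auto
  have E_sets [measurable]: "E \<in> sets borel" unfolding E_def by measurable
  define J where "J = (\<lambda>r. \<integral>\<^sup>+x. indicator E (r *\<^sub>R x :: 'a) \<partial>lborel)"
  have ray: "(\<integral>\<^sup>+r. indicator {1..2} r * indicator E (r *\<^sub>R x) \<partial>lborel) = (0::ennreal)" if "x \<noteq> 0" for x :: 'a
  proof -
    have "(\<integral>\<^sup>+r. indicator {1..2} r * indicator E (r *\<^sub>R x) \<partial>lborel) \<le> (\<integral>\<^sup>+r. indicator N (0 + norm x * r) \<partial>lborel)"
      by (intro nn_integral_mono) (auto simp: E_def mult.commute split: split_indicator)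
    also have "ennreal (norm x) * \<dots> = (\<integral>\<^sup>+r. indicator N r \<partial>lborel)"
      using nn_integral_real_affine[of "indicator N" "norm x" 0] that by simp
    then have "(\<integral>\<^sup>+r. indicator N (0 + norm x * r) \<partial>lborel) = 0"
      using N that by (auto simp: null_sets_def)
    finally show ?thesis by simp
  qed
  have "(\<integral>\<^sup>+r. indicator {1..2} r * J r \<partial>lborel) = (\<integral>\<^sup>+r. (\<integral>\<^sup>+x. indicator {1..2} r * indicator E (r *\<^sub>R x) \<partial>lborel) \<partial>lborel)"
    by (simp add: J_def nn_integral_cmult)
  also have "\<dots> = (\<integral>\<^sup>+x. (\<integral>\<^sup>+r. indicator {1..2} r * indicator E (r *\<^sub>R x) \<partial>lborel) \<partial>lborel)"
    by (rule lborel_pair.Fubini') measurable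
  also have "\<dots> = (\<integral>\<^sup>+x. 0 \<partial>(lborel :: 'a measure))"
    using AE_lborel_singleton[of "0::'a"] ray by (intro nn_integral_cong_AE) auto
  finally have "(\<integral>\<^sup>+r. indicator {1..2} r * J r \<partial>lborel) = 0" by simp
  moreover have [measurable]: "J \<in> borel_measurable borel" unfolding J_def by measurable
  ultimately have "AE r in lborel. indicator {1..2} r * J r = (0::ennreal)"
    by (subst nn_integral_0_iff_AE[symmetric]) auto
  then have "AE r in lborel. r \<in> {1..2} \<longrightarrow> J r = 0"
    by eventually_elim auto
  \<comment> \<open>The interval has positive measure, so a property that holds almost everywhere on
    it has a witness there.\<close>
  moreover have "\<not> (AE r in lborel. r \<notin> {1..2::real})"
  proof
    assume "AE r in lborel. r \<notin> {1..2::real}"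
    then have "emeasure lborel {1..2::real} = 0" by (subst (asm) AE_iff_measurable[of "{1..2}"]) auto
    then show False by simp
  qed
  ultimately obtain r :: real where r: "r \<in> {1..2}" "J r = 0"
    by (smt (verit, best) AE_mp eventually_mono)
  have "emeasure lborel E = emeasure (density (distr lborel borel (\<lambda>x. 0 + r *\<^sub>R x :: 'a)) (\<lambda>_. ennreal (\<bar>r\<bar> ^ DIM('a)))) E"
    using r lborel_affine[of r "0::'a"] by (metis atLeastAtMost_iff not_one_le_zero)
  also have "\<dots> = ennreal (\<bar>r\<bar> ^ DIM('a)) * (\<integral>\<^sup>+x. indicator E x \<partial>distr lborel borel (\<lambda>x. 0 + r *\<^sub>R x :: 'a))"
    by (simp add: emeasure_density nn_integral_cmult)
  also have "(\<integral>\<^sup>+x. indicator E x \<partial>distr lborel borel (\<lambda>x. 0 + r *\<^sub>R x :: 'a)) = (\<integral>\<^sup>+x. indicator E (r *\<^sub>R x) \<partial>lborel)"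
    by (subst nn_integral_distr) auto
  also have "\<dots> = 0" using r by (simp add: J_def)
  finally show ?thesis by (simp add: null_sets_def E_def[symmetric])
qed

section \<open>The distance between two uniform points\<close>

locale uniform_sampling =
  fixes S :: "'a::euclidean_space set"
  assumes S_sets [measurable]: "S \<in> sets borel" and S_pos: "emeasure lborel S \<noteq> 0" and S_fin: "emeasure lborel S \<noteq> \<infinity>"
begin

abbreviation "U \<equiv> uniform_measure lborel S"

lemma prob_space_U: "prob_space U"
  by (rule prob_space_uniform_measure[OF S_pos S_fin])

definition distance_law :: "real measure" where
  "distance_law = distr (U \<Otimes>\<^sub>M U) lborel (\<lambda>(p, q). norm (p - q))"

lemma measurable_distance [measurable]: "(\<lambda>(p, q). norm (p - q)) \<in> measurable (U \<Otimes>\<^sub>M U) borel"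
  by measurable

lemma prob_space_distance_law: "prob_space distance_law"
proof -
  interpret U: prob_space U by (rule prob_space_U)
  interpret UU: pair_prob_space U U ..
  show ?thesis unfolding distance_law_def by (intro UU.prob_space_distr) simp
qed

text \<open>With \<open>p\<close> fixed, the points \<open>q\<close> in question form a translate of
  a null set of the kind treated in \<open>norm_vimage_null_set\<close>; integration over
  \<open>p\<close> finishes. Without absolute continuity the Radon-Nikodym derivative in
  \<open>distance_density\<close> would not represent the law of the distance.\<close>

lemma distance_law_absolutely_continuous: "absolutely_continuous lborel distance_law"
  unfolding absolutely_continuous_def
proof
  fix N :: "real set" assume N: "N \<in> null_sets lborel"
  interpret U: prob_space U by (rule prob_space_U)
  have [measurable]: "N \<in> sets borel" using N by auto
  have null: "emeasure lborel {q. norm (p - q) \<in> N} = 0" for p :: 'a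
  proof -
    have [measurable]: "{x::'a. norm x \<in> N} \<in> sets borel" by measurable
    have "emeasure lborel {q. norm (p - q) \<in> N} = emeasure (distr lborel borel (\<lambda>x. (- p) + x)) {x. norm x \<in> N}"
      by (subst emeasure_distr) (auto intro!: arg_cong[where f="emeasure lborel"] simp: norm_minus_commute)
    also have "\<dots> = 0" unfolding lborel_distr_plus using norm_vimage_null_set[OF N, where 'a='a] by auto
    finally show ?thesis .
  qed
  have "emeasure distance_law N = emeasure (U \<Otimes>\<^sub>M U) ((\<lambda>(p, q). norm (p - q)) -` N \<inter> space (U \<Otimes>\<^sub>M U))"
    unfolding distance_law_def by (rule emeasure_distr) auto
  also have "\<dots> = (\<integral>\<^sup>+p. emeasure U (Pair p -` ((\<lambda>(p, q). norm (p - q)) -` N \<inter> space (U \<Otimes>\<^sub>M U))) \<partial>U)"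
    by (intro U.emeasure_pair_measure_alt measurable_sets[OF measurable_distance]) auto
  also have "\<dots> = (\<integral>\<^sup>+p. 0 \<partial>U)"
  proof (rule nn_integral_cong)
    fix p
    have "Pair p -` ((\<lambda>(p, q). norm (p - q)) -` N \<inter> space (U \<Otimes>\<^sub>M U)) = {q. norm (p - q) \<in> N}"
      by (auto simp: space_pair_measure)
    moreover have "emeasure U {q. norm (p - q) \<in> N} = 0"
    proof -
      have "emeasure lborel (S \<inter> {q. norm (p - q) \<in> N}) \<le> emeasure lborel {q. norm (p - q) \<in> N}"
        by (intro emeasure_mono) auto
      then show ?thesis using null[of p] by (subst emeasure_uniform_measure) auto
    qed
    ultimately show "emeasure U (Pair p -` ((\<lambda>(p, q). norm (p - q)) -` N \<inter> space (U \<Otimes>\<^sub>M U))) = 0" by simp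
  qed
  finally show "N \<in> null_sets distance_law" by (simp add: null_sets_def distance_law_def)
qed

text \<open>The law is a finite measure, so its Radon-Nikodym derivative is finite almost everywhere
  and \<open>enn2real\<close> loses nothing.\<close>

lemma density_distance_density: "density lborel (\<lambda>z. ennreal (distance_density S z)) = distance_law"
proof -
  interpret D: prob_space distance_law by (rule prob_space_distance_law)
  have rn: "density lborel (RN_deriv lborel distance_law) = distance_law"
    by (intro sigma_finite_measure.density_RN_deriv[OF lborel.sigma_finite_measure_axioms] distance_law_absolutely_continuous) (simp add: distance_law_def)
  have "AE z in lborel. RN_deriv lborel distance_law z \<noteq> \<infinity>"
    by (intro sigma_finite_measure.RN_deriv_finite[OF lborel.sigma_finite_measure_axioms] distance_law_absolutely_continuous D.sigma_finite_measure_axioms)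
      (simp add: distance_law_def)
  then have "density lborel (\<lambda>z. ennreal (distance_density S z)) = density lborel (RN_deriv lborel distance_law)"
    by (intro density_cong) (auto simp: distance_density_def distance_law_def[symmetric] less_top)
  with rn show ?thesis by simp
qed

lemma borel_measurable_distance_density [measurable]: "distance_density S \<in> borel_measurable borel"
  unfolding distance_density_def[abs_def] by measurable

text \<open>Measurability is asked of \<open>f\<close> on \<open>{0..}\<close> only, because the
  function to be inserted, \<open>C\<close> at a fixed time lag, is controlled only at nonnegative
  distances. The cut at the diameter is harmless, as both points lie in \<open>S\<close> almost
  surely.\<close>

lemma integral_distance_density:
  fixes f :: "real \<Rightarrow> real"
  assumes S: "compact S" and f: "(\<lambda>z. indicator {0..} z * f z) \<in> borel_measurable borel"
  shows "(LINT z:{0..diameter S}|lborel. f z * distance_density S z) = (LINT (p, q)|(U \<Otimes>\<^sub>M U). f (norm (p - q)))"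
proof -
  interpret U: prob_space U by (rule prob_space_U)
  interpret UU: pair_prob_space U U ..
  define h where "h z = indicator {0..diameter S} z * f z" for z
  have h: "h = (\<lambda>z. indicator {..diameter S} z * (indicator {0..} z * f z))"
    by (auto simp: h_def fun_eq_iff split: split_indicator)
  have [measurable]: "h \<in> borel_measurable borel"
    unfolding h by (rule borel_measurable_times[OF _ f]) simp
  have "(LINT z:{0..diameter S}|lborel. f z * distance_density S z) = (LINT z|lborel. distance_density S z *\<^sub>R h z)"
    unfolding set_lebesgue_integral_def h_def by (intro Bochner_Integration.integral_cong) auto
  also have "\<dots> = (LINT z|density lborel (\<lambda>z. ennreal (distance_density S z)). h z)"
    by (intro integral_density[symmetric]) (auto simp: distance_density_def)
  also have "\<dots> = (LINT pq|(U \<Otimes>\<^sub>M U). h (case pq of (p, q) \<Rightarrow> norm (p - q)))"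
    unfolding density_distance_density distance_law_def by (intro integral_distr) auto
  also have "\<dots> = (LINT (p, q)|(U \<Otimes>\<^sub>M U). f (norm (p - q)))"
  proof -
    have AE_U: "AE p in U. p \<in> S" by (intro AE_uniform_measureI) auto
    have ms: "{pq \<in> space (U \<Otimes>\<^sub>M U). fst pq \<in> S \<and> snd pq \<in> S} \<in> sets (U \<Otimes>\<^sub>M U)"
      by measurable
    have "AE pq in U \<Otimes>\<^sub>M U. fst pq \<in> S \<and> snd pq \<in> S"
    proof (rule UU.AE_pair_measure[OF ms])
      show "AE p in U. AE q in U. fst (p, q) \<in> S \<and> snd (p, q) \<in> S"
        using AE_U
      proof eventually_elim
        case (elim p)
        from AE_U show ?case by eventually_elim (simp add: elim)
      qed
    qed
    then have ae: "AE pq in U \<Otimes>\<^sub>M U. h (case pq of (p, q) \<Rightarrow> norm (p - q)) = (case pq of (p, q) \<Rightarrow> f (norm (p - q)))"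
    proof eventually_elim
      case (elim pq)
      then have "norm (fst pq - snd pq) \<le> diameter S"
        using diameter_bounded_bound[OF compact_imp_bounded[OF S], of "fst pq" "snd pq"] by (simp add: dist_norm)
      then show ?case by (simp add: h_def split_beta')
    qed
    have m: "(\<lambda>pq. h (case pq of (p, q) \<Rightarrow> norm (p - q))) \<in> borel_measurable (U \<Otimes>\<^sub>M U)"
      by measurable
    have eq: "(case pq of (p, q) \<Rightarrow> f (norm (p - q))) = indicator {0..} (norm (fst pq - snd pq)) * f (norm (fst pq - snd pq))" for pq :: "'a \<times> 'a"
      by (simp add: split_beta')
    have "(\<lambda>pq::'a \<times> 'a. norm (fst pq - snd pq)) \<in> borel_measurable (U \<Otimes>\<^sub>M U)" by measurable
    from measurable_compose[OF this f] have m2: "(\<lambda>(p, q). f (norm (p - q))) \<in> borel_measurable (U \<Otimes>\<^sub>M U)"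
      unfolding eq .
    show ?thesis using ae m m2 by (intro integral_cong_AE) auto
  qed
  finally show ?thesis .
qed

end

section \<open>Uniform points of the space-time window\<close>

definition spacetime_uniform :: "'a::euclidean_space set \<Rightarrow> real \<Rightarrow> ('a \<times> real) measure" where
  "spacetime_uniform S T = uniform_measure lborel S \<Otimes>\<^sub>M uniform_measure lborel {0..T}"

text \<open>Valid for nonintegrable \<open>f\<close> as well, where both sides are 0; this allows
  its use on every section of a function of two variables.\<close>

lemma set_integral_uniform_measure:
  fixes f :: "'a::euclidean_space \<Rightarrow> real"
  assumes S[measurable]: "S \<in> sets borel" and S_pos: "emeasure lborel S \<noteq> 0" and S_fin: "emeasure lborel S \<noteq> \<infinity>"
    and f[measurable]: "f \<in> borel_measurable borel"
  shows "(LINT x:S|lborel. f x) = measure lborel S * (LINT x|uniform_measure lborel S. f x)"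
proof -
  have m: "emeasure lborel S = ennreal (measure lborel S)"
    using S_fin by (intro emeasure_eq_ennreal_measure) auto
  have m0: "measure lborel S > 0" using S_pos m by (metis ennreal_0 measure_nonneg order_le_less)
  have "uniform_measure lborel S = density lborel (\<lambda>x. ennreal (indicator S x / measure lborel S))"
    unfolding uniform_measure_def m using m0
    by (intro density_cong) (auto simp: divide_ennreal ennreal_1[symmetric] simp del: ennreal_1 split: split_indicator)
  then have "(LINT x|uniform_measure lborel S. f x) = (LINT x|lborel. (indicator S x / measure lborel S) *\<^sub>R f x)"
    by (simp only:) (rule integral_density, auto)
  also have "\<dots> = (LINT x:S|lborel. f x) / measure lborel S" by (simp add: set_lebesgue_integral_def)
  finally show ?thesis using m0 by simp
qed

locale spacetime_sampling = uniform_sampling S for S :: "'a::euclidean_space set" +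
  fixes T :: real
  assumes T: "T > 0"
begin

abbreviation "I \<equiv> uniform_measure lborel {0..T}"
abbreviation "N \<equiv> spacetime_uniform S T"

sublocale U: prob_space U by (rule prob_space_U)
sublocale I: prob_space I using T by (intro prob_space_uniform_measure) auto
sublocale UI: pair_prob_space U I ..
sublocale UU: pair_prob_space U U ..
sublocale NN: pair_prob_space "U \<Otimes>\<^sub>M I" "U \<Otimes>\<^sub>M I" ..

lemma prob_space_spacetime_uniform: "prob_space N"
  unfolding spacetime_uniform_def by (rule UI.prob_space_axioms)

lemma sets_spacetime_uniform: "sets N = sets borel"
proof -
  have "sets N = sets ((borel :: 'a measure) \<Otimes>\<^sub>M (borel :: real measure))"
    unfolding spacetime_uniform_def by (intro sets_pair_measure_cong) auto
  then show ?thesis by (simp only: borel_prod)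
qed

lemma space_spacetime_uniform: "space N = UNIV"
  using sets_eq_imp_space_eq[OF sets_spacetime_uniform] by simp

lemma set_integral_spacetime:
  fixes f :: "'a \<times> real \<Rightarrow> real"
  assumes f: "f \<in> borel_measurable borel" and int: "integrable N f"
  shows "(LINT t:{0..T}|lborel. LINT x:S|lborel. f (x, t)) = measure lborel S * T * (LINT p|N. f p)"
proof -
  have [measurable]: "f \<in> borel_measurable (borel \<Otimes>\<^sub>M borel)" using f by (simp add: borel_prod)
  have "(LINT t:{0..T}|lborel. LINT x:S|lborel. f (x, t)) = (LINT t:{0..T}|lborel. measure lborel S * (LINT x|U. f (x, t)))"
    by (subst set_integral_uniform_measure[OF S_sets S_pos S_fin]) auto
  also have "\<dots> = T * (LINT t|I. measure lborel S * (LINT x|U. f (x, t)))"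
    using T by (subst set_integral_uniform_measure) auto
  also have "(LINT t|I. measure lborel S * (LINT x|U. f (x, t))) = measure lborel S * (LINT t|I. LINT x|U. f (x, t))"
    by simp
  also have "(LINT t|I. LINT x|U. f (x, t)) = (LINT p|N. f p)"
    using UI.integral_snd[of "\<lambda>x t. f (x, t)"] int by (simp add: spacetime_uniform_def)
  finally show ?thesis by simp
qed

text \<open>Tonelli's theorem, regrouping two space-time points into a pair of times outside and a
  pair of positions inside. For a covariance the inner integral then depends on the times only
  through their lag.\<close>

lemma nn_integral_spacetime_pairs:
  fixes f :: "'a \<times> real \<Rightarrow> 'a \<times> real \<Rightarrow> ennreal"
  assumes "case_prod f \<in> borel_measurable (borel \<Otimes>\<^sub>M borel)"
  shows "(\<integral>\<^sup>+(p, q). f p q \<partial>(N \<Otimes>\<^sub>M N)) = (\<integral>\<^sup>+t. \<integral>\<^sup>+s. \<integral>\<^sup>+(x, y). f (x, t) (y, s) \<partial>(U \<Otimes>\<^sub>M U) \<partial>I \<partial>I)"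
proof -
  have [measurable]: "case_prod f \<in> borel_measurable ((borel \<Otimes>\<^sub>M borel) \<Otimes>\<^sub>M (borel \<Otimes>\<^sub>M borel))"
    using assms by (simp add: borel_prod)
  have "(\<integral>\<^sup>+(p, q). f p q \<partial>(N \<Otimes>\<^sub>M N)) = (\<integral>\<^sup>+p. \<integral>\<^sup>+q. f p q \<partial>(U \<Otimes>\<^sub>M I) \<partial>(U \<Otimes>\<^sub>M I))"
    unfolding spacetime_uniform_def by (subst sigma_finite_measure.nn_integral_fst[OF UI.sigma_finite_measure_axioms, symmetric]) auto
  also have "\<dots> = (\<integral>\<^sup>+t. \<integral>\<^sup>+x. \<integral>\<^sup>+q. f (x, t) q \<partial>(U \<Otimes>\<^sub>M I) \<partial>U \<partial>I)"
    by (rule UI.nn_integral_snd[symmetric]) measurable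
  also have "\<dots> = (\<integral>\<^sup>+t. \<integral>\<^sup>+x. \<integral>\<^sup>+s. \<integral>\<^sup>+y. f (x, t) (y, s) \<partial>U \<partial>I \<partial>U \<partial>I)"
    by (intro nn_integral_cong UI.nn_integral_snd[symmetric]) measurable
  also have "\<dots> = (\<integral>\<^sup>+t. \<integral>\<^sup>+s. \<integral>\<^sup>+x. \<integral>\<^sup>+y. f (x, t) (y, s) \<partial>U \<partial>U \<partial>I \<partial>I)"
    by (intro nn_integral_cong UI.Fubini'[symmetric]) measurable
  also have "\<dots> = (\<integral>\<^sup>+t. \<integral>\<^sup>+s. \<integral>\<^sup>+(x, y). f (x, t) (y, s) \<partial>(U \<Otimes>\<^sub>M U) \<partial>I \<partial>I)"
    by (intro nn_integral_cong U.nn_integral_fst[of "\<lambda>(x, y). f (x, t) (y, s)" for t s, simplified]) measurable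
  finally show ?thesis .
qed

text \<open>This is \<open>nn_integral_time_difference\<close> divided by \<open>T\<^sup>2\<close>,
  with one factor returned by \<open>T - \<tau> = T * (1 - \<tau> / T)\<close>. The bounds on
  \<open>G\<close> permit the passage to a real-valued integral.\<close>

lemma nn_integral_time_pairs:
  fixes G :: "real \<Rightarrow> real"
  assumes [measurable]: "G \<in> borel_measurable borel" and G: "\<And>\<tau>. 0 \<le> G \<tau>" "\<And>\<tau>. G \<tau> \<le> 1"
  shows "(\<integral>\<^sup>+t. \<integral>\<^sup>+s. ennreal (G \<bar>t - s\<bar>) \<partial>I \<partial>I) = ennreal (2 / T * (LINT \<tau>:{0..T}|lborel. (1 - \<tau> / T) * G \<tau>))"
proof -
  have int: "set_integrable lborel {0..T} (\<lambda>\<tau>. (1 - \<tau> / T) * G \<tau>)"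
    unfolding set_integrable_def
  proof (rule integrableI_bounded_set[where A="{0..T}" and B=1])
    show "AE x in lborel. x \<in> {0..T} \<longrightarrow> norm (indicat_real {0..T} x *\<^sub>R ((1 - x / T) * G x)) \<le> 1"
    proof (intro AE_I2 impI)
      fix x assume x: "x \<in> {0..T}"
      then have "0 \<le> 1 - x / T" "1 - x / T \<le> 1" using T by (auto simp: field_simps)
      then have "(1 - x / T) * G x \<le> 1" "0 \<le> (1 - x / T) * G x"
        using G[of x] mult_le_one[of "1 - x / T" "G x"] mult_nonneg_nonneg[of "1 - x / T" "G x"] by blast+
      then show "norm (indicat_real {0..T} x *\<^sub>R ((1 - x / T) * G x)) \<le> 1" using x by simp
    qed
  qed (auto simp: emeasure_bounded_finite[simplified])
  have "(\<integral>\<^sup>+t. \<integral>\<^sup>+s. ennreal (G \<bar>t - s\<bar>) \<partial>I \<partial>I) = (\<integral>\<^sup>+t. (\<integral>\<^sup>+s\<in>{0..T}. ennreal (G \<bar>t - s\<bar>) \<partial>lborel) / ennreal T \<partial>I)"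
    using T by (intro nn_integral_cong, subst nn_integral_uniform_measure) auto
  also have "\<dots> = (\<integral>\<^sup>+t. (\<integral>\<^sup>+s\<in>{0..T}. ennreal (G \<bar>t - s\<bar>) \<partial>lborel) \<partial>I) / ennreal T"
    by (rule nn_integral_divide) measurable
  also have "\<dots> = (\<integral>\<^sup>+t\<in>{0..T}. (\<integral>\<^sup>+s\<in>{0..T}. ennreal (G \<bar>t - s\<bar>) \<partial>lborel) \<partial>lborel) / ennreal T / ennreal T"
    using T by (subst nn_integral_uniform_measure) auto
  also have "\<dots> = 2 * (\<integral>\<^sup>+\<tau>\<in>{0..T}. ennreal (T - \<tau>) * ennreal (G \<tau>) \<partial>lborel) / ennreal T / ennreal T"
    using T by (subst nn_integral_time_difference) auto
  also have "(\<integral>\<^sup>+\<tau>\<in>{0..T}. ennreal (T - \<tau>) * ennreal (G \<tau>) \<partial>lborel) = (\<integral>\<^sup>+\<tau>. ennreal T * ennreal (indicator {0..T} \<tau> *\<^sub>R ((1 - \<tau> / T) * G \<tau>)) \<partial>lborel)"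
  proof (rule nn_integral_cong)
    fix x
    have "ennreal (T - x) * ennreal (G x) = ennreal T * ennreal ((1 - x / T) * G x)" if "x \<in> {0..T}"
    proof -
      have "(T - x) * G x = T * ((1 - x / T) * G x)" using T by (simp add: right_diff_distrib left_diff_distrib)
      moreover have "ennreal (T - x) * ennreal (G x) = ennreal ((T - x) * G x)"
        using G that by (intro ennreal_mult[symmetric]) auto
      ultimately have "ennreal (T - x) * ennreal (G x) = ennreal (T * ((1 - x / T) * G x))" by (simp only:)
      also have "\<dots> = ennreal T * ennreal ((1 - x / T) * G x)"
        using T G that by (intro ennreal_mult) auto
      finally show ?thesis .
    qed
    then show "ennreal (T - x) * ennreal (G x) * indicator {0..T} x = ennreal T * ennreal (indicator {0..T} x *\<^sub>R ((1 - x / T) * G x))"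
      by (auto split: split_indicator)
  qed
  also have "\<dots> = ennreal T * ennreal (LINT \<tau>:{0..T}|lborel. (1 - \<tau> / T) * G \<tau>)"
  proof -
    have nn: "0 \<le> indicator {0..T} \<tau> *\<^sub>R ((1 - \<tau> / T) * G \<tau>)" for \<tau>
      using T G[of \<tau>] by (auto split: split_indicator intro!: mult_nonneg_nonneg)
    have "(\<integral>\<^sup>+\<tau>. ennreal (indicator {0..T} \<tau> *\<^sub>R ((1 - \<tau> / T) * G \<tau>)) \<partial>lborel)
        = ennreal (LINT \<tau>:{0..T}|lborel. (1 - \<tau> / T) * G \<tau>)"
      unfolding set_lebesgue_integral_def
      by (rule nn_integral_eq_integral[OF int[unfolded set_integrable_def]]) (use nn in simp)
    then show ?thesis by (subst nn_integral_cmult) auto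
  qed
  also have "2 * (ennreal T * ennreal (LINT \<tau>:{0..T}|lborel. (1 - \<tau> / T) * G \<tau>)) / ennreal T / ennreal T
    = ennreal (2 / T * (LINT \<tau>:{0..T}|lborel. (1 - \<tau> / T) * G \<tau>))"
  proof -
    have nn: "0 \<le> (LINT \<tau>:{0..T}|lborel. (1 - \<tau> / T) * G \<tau>)"
      unfolding set_lebesgue_integral_def using T G(1) by (intro integral_nonneg_AE AE_I2) (auto split: split_indicator simp: field_simps intro: mult_right_mono)
    have "2 * (ennreal T * ennreal v) / ennreal T / ennreal T = ennreal (2 / T * v)" if "0 \<le> v" for v
    proof -
      have "2 * (ennreal T * ennreal v) = ennreal (2 * (T * v))"
        using T that by (simp add: ennreal_mult)
      then show ?thesis using T that by (simp add: divide_ennreal)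
    qed
    from this[OF nn] show ?thesis .
  qed
  finally show ?thesis .
qed

text \<open>Here the bracket of the normalisation arises: for a fixed time lag, averaging over
  positions is an expectation under the law of the distance, and averaging over times contributes
  the triangular weight.\<close>

lemma covariance_average_eq:
  fixes C :: "real \<Rightarrow> real \<Rightarrow> real"
  assumes S: "compact S"
    and C_meas: "(\<lambda>(z, \<tau>). C \<bar>z\<bar> \<bar>\<tau>\<bar>) \<in> borel_measurable (borel \<Otimes>\<^sub>M borel)"
    and C: "\<And>z \<tau>. 0 \<le> C \<bar>z\<bar> \<bar>\<tau>\<bar>" "\<And>z \<tau>. C \<bar>z\<bar> \<bar>\<tau>\<bar> \<le> 1"
  shows "(LINT (p, q)|(N \<Otimes>\<^sub>M N). C (norm (fst p - fst q)) \<bar>snd p - snd q\<bar>) =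
    2 / T * (LINT \<tau>:{0..T}|lborel. (1 - \<tau> / T) * (LINT z:{0..diameter S}|lborel. C z \<tau> * distance_density S z))"
proof -
  \<comment> \<open>The even extension is measurable and bounded everywhere, whereas
    \<open>C\<close> is unconstrained at negative arguments; the two are identified again only where
    \<open>z\<close> and \<open>\<tau>\<close> are nonnegative.\<close>
  define c where "c z \<tau> = C \<bar>z\<bar> \<bar>\<tau>\<bar>" for z \<tau>
  have c_meas [measurable]: "case_prod c \<in> borel_measurable (borel \<Otimes>\<^sub>M borel)"
    using C_meas by (simp add: c_def[abs_def])
  have c: "0 \<le> c z \<tau>" "c z \<tau> \<le> 1" for z \<tau> using C by (auto simp: c_def)
  define G where "G \<tau> = (LINT (x, y)|(U \<Otimes>\<^sub>M U). c (norm (x - y)) \<tau>)" for \<tau>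
  have cm: "(\<lambda>(x, y). c (norm (x - y)) \<tau>) \<in> borel_measurable (U \<Otimes>\<^sub>M U)" for \<tau>
    by measurable
  have c_int: "integrable (U \<Otimes>\<^sub>M U) (\<lambda>(x, y). c (norm (x - y)) \<tau>)" for \<tau>
    using c by (intro UU.integrable_const_bound[OF _ cm, where B=1]) auto
  have [measurable]: "G \<in> borel_measurable borel"
    unfolding G_def[abs_def] case_prod_unfold by measurable
  have G0: "0 \<le> G \<tau>" for \<tau> unfolding G_def using c by (intro integral_nonneg_AE) auto
  have G1: "G \<tau> \<le> 1" for \<tau>
    unfolding G_def using integral_mono[OF c_int, of "\<lambda>_. 1" \<tau>] c UU.prob_space by (auto simp: split_beta')
  have nnG: "(\<integral>\<^sup>+(x, y). ennreal (c (norm (x - y)) \<tau>) \<partial>(U \<Otimes>\<^sub>M U)) = ennreal (G \<tau>)" for \<tau>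
    unfolding G_def using nn_integral_eq_integral[OF c_int[of \<tau>]] c by (simp add: split_beta')
  interpret N: prob_space N by (rule prob_space_spacetime_uniform)
  interpret N2: pair_prob_space N N ..
  have f_meas [measurable]: "(\<lambda>(p, q). c (norm (fst p - fst q)) (snd p - snd q)) \<in> borel_measurable (N \<Otimes>\<^sub>M N)"
    unfolding spacetime_uniform_def by measurable
  have f_int: "integrable (N \<Otimes>\<^sub>M N) (\<lambda>(p, q). c (norm (fst p - fst q)) (snd p - snd q))"
    using c by (intro N2.integrable_const_bound[OF _ f_meas, where B=1]) auto
  have bm: "(\<lambda>(p::'a \<times> real, q::'a \<times> real). ennreal (c (norm (fst p - fst q)) (snd p - snd q))) \<in> borel_measurable (borel \<Otimes>\<^sub>M borel)"
    unfolding borel_prod[symmetric] by measurable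
  have "ennreal (LINT (p, q)|(N \<Otimes>\<^sub>M N). c (norm (fst p - fst q)) (snd p - snd q))
      = (\<integral>\<^sup>+(p, q). ennreal (c (norm (fst p - fst q)) (snd p - snd q)) \<partial>(N \<Otimes>\<^sub>M N))"
    using nn_integral_eq_integral[OF f_int] c by (simp add: split_beta')
  also have "\<dots> = (\<integral>\<^sup>+t. \<integral>\<^sup>+s. ennreal (G (t - s)) \<partial>I \<partial>I)"
    using nn_integral_spacetime_pairs[OF bm] by (simp add: nnG)
  also have "\<dots> = (\<integral>\<^sup>+t. \<integral>\<^sup>+s. ennreal (G \<bar>t - s\<bar>) \<partial>I \<partial>I)"
    by (simp add: G_def c_def)
  also have "\<dots> = ennreal (2 / T * (LINT \<tau>:{0..T}|lborel. (1 - \<tau> / T) * G \<tau>))"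
    by (rule nn_integral_time_pairs) (use G0 G1 in auto)
  finally have eq: "(LINT (p, q)|(N \<Otimes>\<^sub>M N). c (norm (fst p - fst q)) (snd p - snd q))
      = 2 / T * (LINT \<tau>:{0..T}|lborel. (1 - \<tau> / T) * G \<tau>)"
  proof (subst (asm) ennreal_inj)
    show "0 \<le> (LINT (p, q)|(N \<Otimes>\<^sub>M N). c (norm (fst p - fst q)) (snd p - snd q))"
      using c by (intro integral_nonneg_AE) auto
    have "0 \<le> (LINT \<tau>:{0..T}|lborel. (1 - \<tau> / T) * G \<tau>)"
      unfolding set_lebesgue_integral_def using T G0 by (intro integral_nonneg_AE AE_I2) (auto split: split_indicator simp: field_simps intro: mult_right_mono)
    then show "0 \<le> 2 / T * (LINT \<tau>:{0..T}|lborel. (1 - \<tau> / T) * G \<tau>)" using T by simp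
  qed
  have G_eq: "G \<tau> = (LINT z:{0..diameter S}|lborel. C z \<tau> * distance_density S z)" if "\<tau> \<in> {0..T}" for \<tau>
  proof -
    have "(\<lambda>z. indicator {0..} z * C z \<tau>) = (\<lambda>z. indicator {0..} z * c z \<tau>)"
      using that by (auto simp: c_def fun_eq_iff split: split_indicator)
    then have "(\<lambda>z. indicator {0..} z * C z \<tau>) \<in> borel_measurable borel" by simp
    from integral_distance_density[OF S this]
    show ?thesis using that by (simp add: G_def c_def)
  qed
  have "(LINT \<tau>:{0..T}|lborel. (1 - \<tau> / T) * G \<tau>) =
      (LINT \<tau>:{0..T}|lborel. (1 - \<tau> / T) * (LINT z:{0..diameter S}|lborel. C z \<tau> * distance_density S z))"
    by (intro set_lebesgue_integral_cong) (auto simp: G_eq)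
  then show ?thesis using eq by (simp add: c_def)
qed

lemma close_pairs_sets:
  "{(p, q). norm (fst p - fst q) < A \<and> \<bar>snd p - snd q\<bar> < A} \<in> sets (N \<Otimes>\<^sub>M N)" (is "?E \<in> _")
proof -
  have "{z \<in> space (N \<Otimes>\<^sub>M N). norm (fst (fst z) - fst (snd z)) < A \<and> \<bar>snd (fst z) - snd (snd z)\<bar> < A} \<in> sets (N \<Otimes>\<^sub>M N)"
    unfolding spacetime_uniform_def by measurable
  moreover have "{z \<in> space (N \<Otimes>\<^sub>M N). norm (fst (fst z) - fst (snd z)) < A \<and> \<bar>snd (fst z) - snd (snd z)\<bar> < A} = ?E"
    by (auto simp: space_pair_measure space_spacetime_uniform)
  ultimately show ?thesis by simp
qed

text \<open>With one point fixed, the other must fall into a ball of radius \<open>A\<close> in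
  space and an interval of length \<open>2 * A\<close> in time. The bound is uniform in the fixed
  point and decays like the inverse volume.\<close>

lemma close_pairs_measure_le:
  assumes A: "A > 0"
  shows "measure (N \<Otimes>\<^sub>M N) {(p, q). norm (fst p - fst q) < A \<and> \<bar>snd p - snd q\<bar> < A}
    \<le> measure lborel (ball (0::'a) A) * (2 * A) / (measure lborel S * T)"
proof -
  interpret N: prob_space N by (rule prob_space_spacetime_uniform)
  interpret N2: pair_prob_space N N ..
  define E where "E = {(p::'a \<times> real, q::'a \<times> real). norm (fst p - fst q) < A \<and> \<bar>snd p - snd q\<bar> < A}"
  have E_sets: "E \<in> sets (N \<Otimes>\<^sub>M N)" unfolding E_def by (rule close_pairs_sets)
  have m: "emeasure lborel S = ennreal (measure lborel S)"
    using S_fin by (intro emeasure_eq_ennreal_measure) auto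
  have m0: "measure lborel S > 0" using S_pos m by (metis ennreal_0 measure_nonneg order_le_less)
  have slice: "measure N (Pair p -` E) \<le> measure lborel (ball (0::'a) A) * (2 * A) / (measure lborel S * T)" for p
  proof -
    have "Pair p -` E = ball (fst p) A \<times> ball (snd p) A"
      by (auto simp: E_def dist_norm)
    then have "measure N (Pair p -` E) = measure U (ball (fst p) A) * measure I (ball (snd p) A)"
      unfolding spacetime_uniform_def by (simp add: measure_def I.emeasure_pair_measure_Times enn2real_mult)
    moreover have "measure U (ball (fst p) A) \<le> measure lborel (ball (0::'a) A) / measure lborel S"
    proof -
      have "measure U (ball (fst p) A) = measure lborel (S \<inter> ball (fst p) A) / measure lborel S"
        using S_pos S_fin by (subst measure_uniform_measure) auto
      also have "measure lborel (S \<inter> ball (fst p) A) \<le> measure lborel (ball (fst p) A)"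
        by (intro measure_mono_fmeasurable) (auto simp: fmeasurable_def emeasure_bounded_finite[simplified])
      also have "measure lborel (ball (fst p) A) = measure lborel (ball (0::'a) A)"
        using content_ball[of A "fst p"] content_ball[of A "0::'a"] A by simp
      finally show ?thesis using m0 by (simp add: divide_right_mono)
    qed
    moreover have "measure I (ball (snd p) A) \<le> 2 * A / T"
    proof -
      have "measure I (ball (snd p) A) = measure lborel ({0..T} \<inter> ball (snd p) A) / T"
        using T by (subst measure_uniform_measure) auto
      also have "measure lborel ({0..T} \<inter> ball (snd p) A) \<le> measure lborel (ball (snd p) A)"
        by (intro measure_mono_fmeasurable) (auto simp: fmeasurable_def emeasure_bounded_finite[simplified])
      also have "\<dots> = 2 * A" using A by (simp add: ball_eq_greaterThanLessThan)
      finally show ?thesis using T by (simp add: divide_right_mono)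
    qed
    ultimately have "measure N (Pair p -` E) \<le> (measure lborel (ball (0::'a) A) / measure lborel S) * (2 * A / T)"
      by (simp only:) (rule mult_mono, auto)
    then show ?thesis by simp
  qed
  have "emeasure (N \<Otimes>\<^sub>M N) E = (\<integral>\<^sup>+p. emeasure N (Pair p -` E) \<partial>N)"
    by (rule N.emeasure_pair_measure_alt[OF E_sets])
  also have "\<dots> \<le> (\<integral>\<^sup>+p. ennreal (measure lborel (ball (0::'a) A) * (2 * A) / (measure lborel S * T)) \<partial>N)"
    by (intro nn_integral_mono) (simp add: N.emeasure_eq_measure slice ennreal_leI)
  also have "\<dots> = ennreal (measure lborel (ball (0::'a) A) * (2 * A) / (measure lborel S * T))"
    by (simp add: N.emeasure_space_1)
  finally show ?thesis
    using A T by (simp add: N2.emeasure_eq_measure E_def[symmetric] ennreal_le_iff)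
qed

end

section \<open>The sojourn functional of a Gaussian field\<close>

lemma std_normal_density_pos: "0 < std_normal_density u"
  by (simp add: normal_density_pos)

locale unit_gaussian_field = prob_space M
  for M :: "'w measure" +
  fixes Z :: "'a::euclidean_space \<Rightarrow> real \<Rightarrow> 'w \<Rightarrow> real" and C :: "real \<Rightarrow> real \<Rightarrow> real"
  assumes measurable: "measurable_field M Z" and ms_cont: "mean_square_continuous M Z"
    and gaussian: "gaussian_field M Z"
    and mean: "\<And>x t. expectation (Z x t) = 0"
    and unit_variance: "\<And>x t. expectation (\<lambda>\<omega>. (Z x t \<omega>)\<^sup>2) = 1"
    and covariance: "\<And>x t y s. expectation (\<lambda>\<omega>. Z x t \<omega> * Z y s \<omega>) = C (norm (x - y)) \<bar>t - s\<bar>"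
    and nonneg: "\<And>x t y s. C (norm (x - y :: 'a)) \<bar>t - s\<bar> \<ge> 0"
    and decay: "\<And>\<epsilon>. \<epsilon> > 0 \<Longrightarrow> \<exists>A. \<forall>z\<ge>0. \<forall>\<tau>\<ge>0. max z \<tau> \<ge> A \<longrightarrow> \<bar>C z \<tau>\<bar> < \<epsilon>"
begin

definition X :: "'a \<times> real \<Rightarrow> 'w \<Rightarrow> real" where
  "X p \<omega> = Z (fst p) (snd p) \<omega>"

definition cov :: "'a \<times> real \<Rightarrow> 'a \<times> real \<Rightarrow> real" where
  "cov p q = C (norm (fst p - fst q)) \<bar>snd p - snd q\<bar>"

lemma X_measurable: "case_prod X \<in> borel_measurable ((borel :: ('a \<times> real) measure) \<Otimes>\<^sub>M M)"
  using measurable by (simp add: measurable_field_def X_def[abs_def] split_beta')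

lemma X_component [measurable]: "X p \<in> borel_measurable M"
  using measurable_compose[OF measurable_Pair1' X_measurable, of p] by simp

lemma X_second_moment: "expectation (\<lambda>\<omega>. (X p \<omega>)\<^sup>2) = 1"
  using unit_variance by (simp add: X_def)

lemma X_square_integrable: "integrable M (\<lambda>\<omega>. (X p \<omega>)\<^sup>2)"
  using X_second_moment[of p] not_integrable_integral_eq by fastforce

lemma X_mean: "expectation (X p) = 0"
  using mean by (simp add: X_def[abs_def])

lemma X_cov: "expectation (\<lambda>\<omega>. X p \<omega> * X q \<omega>) = cov p q"
  using covariance by (simp add: X_def cov_def)

lemma cov_nonneg: "0 \<le> cov p q"
  using nonneg by (simp add: cov_def)

lemma cov_le_1: "cov p q \<le> 1"
proof -
  have "expectation (\<lambda>\<omega>. X p \<omega> * X q \<omega>) \<le> expectation (\<lambda>\<omega>. ((X p \<omega>)\<^sup>2 + (X q \<omega>)\<^sup>2) / 2)"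
  proof (rule integral_mono)
    show "X p \<omega> * X q \<omega> \<le> ((X p \<omega>)\<^sup>2 + (X q \<omega>)\<^sup>2) / 2" for \<omega>
      using sum_squares_bound[of "X p \<omega>" "X q \<omega>"] by simp
    show "integrable M (\<lambda>\<omega>. X p \<omega> * X q \<omega>)"
      by (intro integrable_mult_of_squares X_square_integrable) auto
  qed (use X_square_integrable in simp)
  also have "\<dots> = 1" using X_square_integrable X_second_moment by simp
  finally show ?thesis by (simp add: X_cov)
qed

lemma cov_self: "cov p p = 1"
  using X_cov[of p p] X_second_moment[of p] by (simp add: power2_eq_square)

text \<open>Every distance is realised along a unit vector \<open>e\<close>, so what holds for the
  covariance of the field carries over to \<open>C\<close> as a function of two real
  variables.\<close>

lemma C_abs_eq_cov: "\<exists>e. \<forall>z \<tau>. C \<bar>z\<bar> \<bar>\<tau>\<bar> = cov (z *\<^sub>R e, \<tau>) (0, 0)"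
proof -
  obtain e :: 'a where "e \<in> Basis" using nonempty_Basis by blast
  then have "norm e = 1" by simp
  then have "\<forall>z \<tau>. C \<bar>z\<bar> \<bar>\<tau>\<bar> = cov (z *\<^sub>R e, \<tau>) (0, 0)" by (simp add: cov_def)
  then show ?thesis by blast
qed

lemma C_abs_bounds: "0 \<le> C \<bar>z\<bar> \<bar>\<tau>\<bar>" "C \<bar>z\<bar> \<bar>\<tau>\<bar> \<le> 1"
proof -
  obtain e :: 'a where e: "\<And>z \<tau>. C \<bar>z\<bar> \<bar>\<tau>\<bar> = cov (z *\<^sub>R e, \<tau>) (0, 0)"
    using C_abs_eq_cov by auto
  show "0 \<le> C \<bar>z\<bar> \<bar>\<tau>\<bar>" "C \<bar>z\<bar> \<bar>\<tau>\<bar> \<le> 1" unfolding e by (rule cov_nonneg cov_le_1)+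
qed

text \<open>Measurability of \<open>C\<close> is inherited from the joint measurability of the
  field, its values being expectations that depend on parameters.\<close>

lemma C_abs_measurable: "(\<lambda>(z, \<tau>). C \<bar>z\<bar> \<bar>\<tau>\<bar>) \<in> borel_measurable (borel \<Otimes>\<^sub>M borel)"
proof -
  obtain e :: 'a where e: "\<And>z \<tau>. C \<bar>z\<bar> \<bar>\<tau>\<bar> = cov (z *\<^sub>R e, \<tau>) (0, 0)" using C_abs_eq_cov by auto
  have [measurable]: "case_prod X \<in> borel_measurable ((borel \<Otimes>\<^sub>M borel) \<Otimes>\<^sub>M M)"
    using X_measurable by (simp add: borel_prod)
  have "(\<lambda>(z, \<tau>). expectation (\<lambda>\<omega>. X (z *\<^sub>R e, \<tau>) \<omega> * X (0, 0) \<omega>)) \<in> borel_measurable (borel \<Otimes>\<^sub>M borel)"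
    unfolding case_prod_unfold by measurable
  then show ?thesis by (simp add: X_cov e)
qed

lemma X_gaussian_sum:
  assumes "finite S"
  shows "gaussian_rv M (\<lambda>\<omega>. \<Sum>p\<in>S. a p * X p \<omega>)"
  using gaussian assms by (simp add: gaussian_field_def X_def split_beta')

lemma X_ms_cont: "((\<lambda>q. expectation (\<lambda>\<omega>. (X q \<omega> - X p \<omega>)\<^sup>2)) \<longlongrightarrow> 0) (at p)"
proof -
  have "((\<lambda>(y, s). expectation (\<lambda>\<omega>. (Z y s \<omega> - Z (fst p) (snd p) \<omega>)\<^sup>2)) \<longlongrightarrow> 0) (at (fst p, snd p))"
    using ms_cont unfolding mean_square_continuous_def by blast
  then show ?thesis by (simp add: X_def split_beta')
qed

lemma borel_measurable_double_integral:
  assumes [measurable]: "A \<in> sets borel" "S \<in> sets borel" "g \<in> borel_measurable (borel :: real measure)"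
  shows "(\<lambda>\<omega>. LINT t:A|lborel. LINT x:S|lborel. (g (Z x t \<omega>) :: real)) \<in> borel_measurable M"
proof -
  have [measurable]: "case_prod X \<in> borel_measurable ((borel \<Otimes>\<^sub>M borel) \<Otimes>\<^sub>M M)"
    using X_measurable by (simp add: borel_prod)
  have "(\<lambda>\<omega>. LINT t:A|lborel. LINT x:S|lborel. g (X (x, t) \<omega>)) \<in> borel_measurable M"
    unfolding set_lebesgue_integral_def by measurable
  then show ?thesis by (simp add: X_def)
qed

abbreviation "h u p \<omega> \<equiv> hermite_remainder u (X p \<omega>)"

lemma h_square_integrable: "integrable M (\<lambda>\<omega>. (h u p \<omega>)\<^sup>2)"
  and h_second_moment: "expectation (\<lambda>\<omega>. (h u p \<omega>)\<^sup>2) \<le> 4"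
proof -
  have i: "integrable M (\<lambda>\<omega>. 2 + 2 * (X p \<omega>)\<^sup>2)" using X_square_integrable by simp
  have le: "norm ((hermite_remainder u v)\<^sup>2) \<le> norm (2 + 2 * v\<^sup>2)" for v
    using hermite_remainder_sq_le[of u v] by simp
  show hi: "integrable M (\<lambda>\<omega>. (h u p \<omega>)\<^sup>2)"
    by (rule Bochner_Integration.integrable_bound[OF i]) (use le in simp_all)
  have "expectation (\<lambda>\<omega>. (h u p \<omega>)\<^sup>2) \<le> expectation (\<lambda>\<omega>. 2 + 2 * (X p \<omega>)\<^sup>2)"
    by (intro integral_mono hi i hermite_remainder_sq_le)
  also have "\<dots> = 4" using X_square_integrable X_second_moment by (simp add: prob_space)
  finally show "expectation (\<lambda>\<omega>. (h u p \<omega>)\<^sup>2) \<le> 4" .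
qed

lemma h_cov_le_4: "expectation (\<lambda>\<omega>. h u p \<omega> * h u q \<omega>) \<le> 4"
proof -
  have "expectation (\<lambda>\<omega>. h u p \<omega> * h u q \<omega>) \<le> expectation (\<lambda>\<omega>. ((h u p \<omega>)\<^sup>2 + (h u q \<omega>)\<^sup>2) / 2)"
  proof (rule integral_mono)
    show "h u p \<omega> * h u q \<omega> \<le> ((h u p \<omega>)\<^sup>2 + (h u q \<omega>)\<^sup>2) / 2" for \<omega>
      using sum_squares_bound[of "h u p \<omega>" "h u q \<omega>"] by simp
    show "integrable M (\<lambda>\<omega>. h u p \<omega> * h u q \<omega>)"
      by (intro integrable_mult_of_squares h_square_integrable) measurable
  qed (use h_square_integrable in simp)
  also have "\<dots> \<le> 4" using h_square_integrable h_second_moment[of u p] h_second_moment[of u q] by simp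
  finally show ?thesis .
qed

lemma h_cov_small:
  assumes u: "u \<ge> 0" and small: "cov p q \<le> 1 / 2"
  shows "expectation (\<lambda>\<omega>. h u p \<omega> * h u q \<omega>) \<le> (cov p q)\<^sup>2 * hermite_remainder_const u"
proof -
  \<comment> \<open>The two coefficients can be placed on the set \<open>{p, q}\<close> only if the
    points differ; coinciding points would have covariance 1.\<close>
  have "p \<noteq> q" using small cov_self[of p] by auto
  have g: "gaussian_rv M (\<lambda>\<omega>. a * X p \<omega> + b * X q \<omega>)" for a b
    using X_gaussian_sum[of "{p, q}" "\<lambda>r. if r = p then a else b"] \<open>p \<noteq> q\<close> by simp
  have "\<bar>expectation (\<lambda>\<omega>. h u p \<omega> * h u q \<omega>)\<bar> \<le> (cov p q)\<^sup>2 * hermite_remainder_const u"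
    by (rule hermite_remainder_covariance[OF _ _ g X_mean X_mean X_second_moment X_second_moment X_cov cov_nonneg small u]) auto
  then show ?thesis by simp
qed

text \<open>For distant pairs the covariance is small, so one factor of
  \<open>(cov p q)\<^sup>2\<close> is traded for \<open>\<epsilon>\<close> while the other is kept;
  summed up, they cost a small multiple of the main variance. Close pairs receive the trivial bound
  4, where the nonnegative term \<open>\<epsilon> * cov p q\<close> does no harm.\<close>

lemma h_cov_bound:
  assumes u: "u \<ge> 0" and \<epsilon>: "\<epsilon> > 0"
  obtains A where "A > 0" "\<And>p q. expectation (\<lambda>\<omega>. h u p \<omega> * h u q \<omega>)
    \<le> \<epsilon> * cov p q + 4 * indicator {(p, q). norm (fst p - fst q) < A \<and> \<bar>snd p - snd q\<bar> < A} (p, q)"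
proof -
  define K where "K = max 1 (hermite_remainder_const u)"
  \<comment> \<open>The value 1/2 gives access to the quadratic bound and
    \<open>\<epsilon> / K\<close> absorbs its constant; the maximum with 1 in \<open>K\<close> keeps
    the division safe.\<close>
  define \<eta> where "\<eta> = min (1 / 2) (\<epsilon> / K)"
  have K: "K > 0" "hermite_remainder_const u \<le> K" by (auto simp: K_def)
  have \<eta>: "\<eta> > 0" "\<eta> \<le> 1 / 2" "\<eta> * K \<le> \<epsilon>" using \<epsilon> K by (auto simp: \<eta>_def min_def field_simps)
  obtain A0 where A0: "\<forall>z\<ge>0. \<forall>\<tau>\<ge>0. max z \<tau> \<ge> A0 \<longrightarrow> \<bar>C z \<tau>\<bar> < \<eta>" using decay[OF \<eta>(1)] by blast
  define A where "A = max A0 1"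
  have "expectation (\<lambda>\<omega>. h u p \<omega> * h u q \<omega>)
    \<le> \<epsilon> * cov p q + 4 * indicator {(p, q). norm (fst p - fst q) < A \<and> \<bar>snd p - snd q\<bar> < A} (p, q)" for p q
  proof (cases "norm (fst p - fst q) < A \<and> \<bar>snd p - snd q\<bar> < A")
    case True
    have "0 \<le> \<epsilon> * cov p q" using \<epsilon> cov_nonneg by simp
    then show ?thesis using True h_cov_le_4[of u p q] by simp
  next
    case False
    then have "A0 \<le> max (norm (fst p - fst q)) \<bar>snd p - snd q\<bar>" by (auto simp: A_def)
    then have "\<bar>cov p q\<bar> < \<eta>" using A0 unfolding cov_def by simp
    then have c: "cov p q \<le> \<eta>" by simp
    have "expectation (\<lambda>\<omega>. h u p \<omega> * h u q \<omega>) \<le> (cov p q)\<^sup>2 * hermite_remainder_const u"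
      using c \<eta> by (intro h_cov_small u) simp
    also have "\<dots> \<le> (cov p q)\<^sup>2 * K" using K by (intro mult_left_mono) auto
    also have "\<dots> = cov p q * (cov p q * K)" by (simp add: power2_eq_square)
    also have "\<dots> \<le> cov p q * (\<eta> * K)" using c K cov_nonneg by (intro mult_left_mono mult_right_mono) auto
    also have "\<dots> \<le> cov p q * \<epsilon>" using \<eta> cov_nonneg by (intro mult_left_mono) auto
    finally show ?thesis using False by (auto simp: mult.commute)
  qed
  then show ?thesis by (rule that[of A, rotated]) (simp add: A_def)
qed

end

section \<open>The averaged functionals over one window\<close>

locale sampled_gaussian_field = unit_gaussian_field M Z C + spacetime_sampling S T
  for M :: "'w measure" and Z :: "'a::euclidean_space \<Rightarrow> real \<Rightarrow> 'w \<Rightarrow> real" and C and S :: "'a set" and T +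
  assumes S_compact: "compact S"
begin

text \<open>\<open>V\<close> is the volume of the window and \<open>c\<close> turns out to be the
  variance of \<open>avg\<close>, so the integral of the field has variance
  \<open>V\<^sup>2 * c\<close>.\<close>

definition "V = measure lborel S * T"
definition "avg = averaged_field.average N X"
definition "avg_h u = averaged_field.average N (h u)"
definition "avg_I u = averaged_field.average N (\<lambda>p \<omega>. indicator {u..} (X p \<omega>))"
definition "c = (LINT (p, q)|(N \<Otimes>\<^sub>M N). cov p q)"

lemma V_pos: "V > 0"
proof -
  have "emeasure lborel S = ennreal (measure lborel S)"
    using S_fin by (intro emeasure_eq_ennreal_measure) auto
  then have "measure lborel S > 0" using S_pos by (metis ennreal_0 measure_nonneg order_le_less)
  then show ?thesis using T by (simp add: V_def)
qed

lemma field_N: "case_prod X \<in> borel_measurable (N \<Otimes>\<^sub>M M)"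
  using X_measurable measurable_cong_sets[OF sets_pair_measure_cong[OF sets_spacetime_uniform refl] refl] by blast

lemma averaged_X: "averaged_field M N X 1"
proof -
  interpret N: prob_space N by (rule prob_space_spacetime_uniform)
  show ?thesis by unfold_locales (auto simp: X_second_moment X_square_integrable field_N)
qed

lemma averaged_h: "averaged_field M N (h u) 4"
proof -
  interpret N: prob_space N by (rule prob_space_spacetime_uniform)
  have [measurable]: "case_prod X \<in> borel_measurable (N \<Otimes>\<^sub>M M)" by (rule field_N)
  have "(\<lambda>(p, \<omega>). h u p \<omega>) \<in> borel_measurable (N \<Otimes>\<^sub>M M)" by measurable
  then show ?thesis by unfold_locales (auto simp: h_second_moment h_square_integrable)
qed

lemma averaged_I: "averaged_field M N (\<lambda>p \<omega>. indicator {u..} (X p \<omega>)) 1"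
proof -
  interpret N: prob_space N by (rule prob_space_spacetime_uniform)
  have [measurable]: "case_prod X \<in> borel_measurable (N \<Otimes>\<^sub>M M)" by (rule field_N)
  have m: "(\<lambda>(p, \<omega>). indicat_real {u..} (X p \<omega>)) \<in> borel_measurable (N \<Otimes>\<^sub>M M)" by measurable
  have i: "integrable M (\<lambda>\<omega>. (indicat_real {u..} (X p \<omega>))\<^sup>2)" for p
    by (intro integrable_const_bound[where B=1]) (auto split: split_indicator)
  have "expectation (\<lambda>\<omega>. (indicat_real {u..} (X p \<omega>))\<^sup>2) \<le> expectation (\<lambda>_. 1)" for p
    by (intro integral_mono i) (auto split: split_indicator)
  then show ?thesis using m i by unfold_locales (auto simp: prob_space)
qed

lemma avg_measurable [measurable]: "avg \<in> borel_measurable M" "avg_h u \<in> borel_measurable M" "avg_I u \<in> borel_measurable M"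
  unfolding avg_def avg_h_def avg_I_def
  by (intro averaged_field.average_measurable[OF averaged_X] averaged_field.average_measurable[OF averaged_h]
    averaged_field.average_measurable[OF averaged_I])+

lemma avg_square: "integrable M (\<lambda>\<omega>. (avg \<omega>)\<^sup>2)" "expectation (\<lambda>\<omega>. (avg \<omega>)\<^sup>2) = c"
  using averaged_field.integrable_average_square[OF averaged_X] averaged_field.expectation_average_square[OF averaged_X]
  by (auto simp: avg_def c_def X_cov)

lemma c_nonneg: "0 \<le> c"
  unfolding c_def using cov_nonneg by (intro integral_nonneg_AE) auto

lemma avg_mean: "expectation avg = 0"
  using averaged_field.expectation_average[OF averaged_X] by (simp add: avg_def X_mean)

lemma avg_char: "expectation (\<lambda>\<omega>. iexp (\<theta> * avg \<omega>)) = exp (- (\<theta>\<^sup>2 * c) / 2)"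
  using gaussian_average_char[OF averaged_X sets_spacetime_uniform X_gaussian_sum X_mean X_ms_cont, of \<theta>] avg_square
  by (simp add: avg_def)

text \<open>The pair bound is integrated over independent sample points; 8 is the bound 4 for close
  pairs times the 2 from the length \<open>2 * A\<close> of the time interval.\<close>

lemma avg_h_square_le:
  assumes A: "A > 0" and bound: "\<And>p q. expectation (\<lambda>\<omega>. h u p \<omega> * h u q \<omega>)
    \<le> \<epsilon> * cov p q + 4 * indicator {(p, q). norm (fst p - fst q) < A \<and> \<bar>snd p - snd q\<bar> < A} (p, q)"
  shows "expectation (\<lambda>\<omega>. (avg_h u \<omega>)\<^sup>2) \<le> \<epsilon> * c + 8 * A * measure lborel (ball (0::'a) A) / V"
proof -
  interpret N: prob_space N by (rule prob_space_spacetime_uniform)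
  interpret N2: pair_prob_space N N ..
  let ?E = "{(p::'a \<times> real, q::'a \<times> real). norm (fst p - fst q) < A \<and> \<bar>snd p - snd q\<bar> < A}"
  have E_sets [measurable]: "?E \<in> sets (N \<Otimes>\<^sub>M N)" by (rule close_pairs_sets)
  have i1: "integrable (N \<Otimes>\<^sub>M N) (\<lambda>(p, q). expectation (\<lambda>\<omega>. h u p \<omega> * h u q \<omega>))"
    by (rule averaged_field.integrable_covariance[OF averaged_h])
  have i2: "integrable (N \<Otimes>\<^sub>M N) (\<lambda>(p, q). cov p q)"
    using averaged_field.integrable_covariance[OF averaged_X] by (simp add: X_cov)
  have i3: "integrable (N \<Otimes>\<^sub>M N) (indicat_real ?E)"
    by (intro integrable_real_indicator) (auto simp: N2.emeasure_eq_measure)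
  have "expectation (\<lambda>\<omega>. (avg_h u \<omega>)\<^sup>2) = (LINT z|(N \<Otimes>\<^sub>M N). (\<lambda>(p, q). expectation (\<lambda>\<omega>. h u p \<omega> * h u q \<omega>)) z)"
    unfolding avg_h_def by (rule averaged_field.expectation_average_square[OF averaged_h])
  also have "\<dots> \<le> (LINT z|(N \<Otimes>\<^sub>M N). \<epsilon> * (\<lambda>(p, q). cov p q) z + 4 * indicator ?E z)"
    using i1 i2 i3 bound by (intro integral_mono) auto
  also have "\<dots> = \<epsilon> * c + 4 * measure (N \<Otimes>\<^sub>M N) ?E"
    using i2 i3 by (simp add: c_def)
  also have "\<dots> \<le> \<epsilon> * c + 4 * (measure lborel (ball (0::'a) A) * (2 * A) / V)"
    unfolding V_def by (intro add_left_mono mult_left_mono close_pairs_measure_le A) simp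
  finally show ?thesis by (simp add: mult_ac)
qed

lemma avg_decomposition: "AE \<omega> in M. avg_I u \<omega> - (1 - std_normal_cdf u) = std_normal_density u * avg \<omega> + avg_h u \<omega>"
proof -
  interpret N: prob_space N by (rule prob_space_spacetime_uniform)
  show ?thesis
    using averaged_field.AE_integrable_field[OF averaged_X] averaged_field.AE_integrable_field[OF averaged_I, of u]
  proof eventually_elim
    case (elim \<omega>)
    have "avg_h u \<omega> = (LINT p|N. h u p \<omega>)"
      by (simp add: avg_h_def averaged_field.average_def[OF averaged_h])
    with elim show ?case
      by (simp add: avg_def avg_I_def averaged_field.average_def[OF averaged_X]
        averaged_field.average_def[OF averaged_I] hermite_remainder_def N.prob_space)
  qed
qed

text \<open>The normalised functional, multiplied by \<open>\<theta>\<close>, differs from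
  \<open>\<theta> / sqrt c * avg\<close> by a multiple of the averaged remainder. The latter
  variable is exactly Gaussian with variance \<open>\<theta>\<^sup>2\<close>, so its characteristic
  function is already the limiting one, and only the ratio of the second moment of the remainder to
  \<open>c\<close> is left to control.\<close>

lemma normalised_char_le:
  assumes cpos: "c > 0"
  shows "cmod (expectation (\<lambda>\<omega>. iexp (\<theta> * ((avg_I u \<omega> - (1 - std_normal_cdf u)) / (std_normal_density u * sqrt c)))) - exp (- \<theta>\<^sup>2 / 2))
    \<le> sqrt (\<theta>\<^sup>2 / (std_normal_density u)\<^sup>2 * (expectation (\<lambda>\<omega>. (avg_h u \<omega>)\<^sup>2) / c))"
proof -
  let ?Y = "\<lambda>\<omega>. \<theta> * ((avg_I u \<omega> - (1 - std_normal_cdf u)) / (std_normal_density u * sqrt c))"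
  let ?G = "\<lambda>\<omega>. (\<theta> / sqrt c) * avg \<omega>"
  let ?k = "\<theta>\<^sup>2 / (std_normal_density u)\<^sup>2 / c"
  have eq: "AE \<omega> in M. (?Y \<omega> - ?G \<omega>)\<^sup>2 = ?k * (avg_h u \<omega>)\<^sup>2"
    using avg_decomposition[of u]
  proof eventually_elim
    case (elim \<omega>)
    have "?Y \<omega> - ?G \<omega> = \<theta> / (std_normal_density u * sqrt c) * avg_h u \<omega>"
      unfolding elim using cpos std_normal_density_pos[of u] by (simp add: field_simps)
    then show ?case using cpos by (simp add: power_mult_distrib power_divide)
  qed
  have ih: "integrable M (\<lambda>\<omega>. (avg_h u \<omega>)\<^sup>2)"
    unfolding avg_h_def by (rule averaged_field.integrable_average_square[OF averaged_h])
  have i: "integrable M (\<lambda>\<omega>. (?Y \<omega> - ?G \<omega>)\<^sup>2)"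
    using eq ih by (subst integrable_cong_AE[where g="\<lambda>\<omega>. ?k * (avg_h u \<omega>)\<^sup>2"]) auto
  have e: "expectation (\<lambda>\<omega>. (?Y \<omega> - ?G \<omega>)\<^sup>2) = ?k * expectation (\<lambda>\<omega>. (avg_h u \<omega>)\<^sup>2)"
    using eq by (subst integral_cong_AE[where g="\<lambda>\<omega>. ?k * (avg_h u \<omega>)\<^sup>2"]) auto
  have "expectation (\<lambda>\<omega>. iexp (?G \<omega>)) = exp (- \<theta>\<^sup>2 / 2)"
    using avg_char[of "\<theta> / sqrt c"] cpos by (simp add: power_divide)
  moreover have "cmod (expectation (\<lambda>\<omega>. iexp (?Y \<omega>)) - expectation (\<lambda>\<omega>. iexp (?G \<omega>))) \<le> sqrt (expectation (\<lambda>\<omega>. (?Y \<omega> - ?G \<omega>)\<^sup>2))"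
    by (rule char_fun_dist_le[OF _ _ i]) measurable
  ultimately show ?thesis unfolding e by (simp add: mult_ac)
qed

lemma double_integral_field:
  "AE \<omega> in M. (LINT t:{0..T}|lborel. LINT x:S|lborel. Z x t \<omega>) = V * avg \<omega>"
  using averaged_field.AE_integrable_field[OF averaged_X]
proof eventually_elim
  case (elim \<omega>)
  have "(\<lambda>p. X p \<omega>) \<in> borel_measurable borel"
    using elim sets_spacetime_uniform measurable_cong_sets[OF sets_spacetime_uniform refl] by (auto dest!: borel_measurable_integrable)
  from set_integral_spacetime[OF this elim] show ?case
    by (simp add: X_def V_def avg_def averaged_field.average_def[OF averaged_X])
qed

text \<open>Indicators are bounded, so every path is integrable over the window and the identity
  holds at each \<open>\<omega>\<close>, whereas for the field itself it is obtained almost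
  everywhere.\<close>

lemma sojourn_eq:
  assumes "\<omega> \<in> space M"
  shows "(LINT t:{0..T}|lborel. LINT x:S|lborel. indicator {u..} (Z x t \<omega>)) = V * avg_I u \<omega>"
proof -
  interpret N: prob_space N by (rule prob_space_spacetime_uniform)
  have [measurable]: "(\<lambda>p. X p \<omega>) \<in> borel_measurable borel"
    using measurable_compose[OF measurable_Pair2'[OF assms] X_measurable] by simp
  have m: "(\<lambda>p. indicat_real {u..} (X p \<omega>)) \<in> borel_measurable borel" by measurable
  have "integrable N (\<lambda>p. indicat_real {u..} (X p \<omega>))"
  proof (rule N.integrable_const_bound[where B=1])
    show "(\<lambda>p. indicat_real {u..} (X p \<omega>)) \<in> borel_measurable N"
      using m by (simp only: measurable_cong_sets[OF sets_spacetime_uniform refl])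
  qed (auto split: split_indicator)
  from set_integral_spacetime[OF m this] show ?thesis
    unfolding avg_I_def averaged_field.average_def[OF averaged_I] V_def by (simp add: X_def)
qed

lemma variance_double_integral:
  "variance (\<lambda>\<omega>. LINT t:{0..T}|lborel. LINT x:S|lborel. Z x t \<omega>) = V\<^sup>2 * c"
proof -
  let ?D = "\<lambda>\<omega>. LINT t:{0..T}|lborel. LINT x:S|lborel. Z x t \<omega>"
  have [measurable]: "?D \<in> borel_measurable M"
    by (rule borel_measurable_double_integral[where g="\<lambda>z. z"]) auto
  have m: "expectation ?D = 0"
    using double_integral_field avg_mean by (subst integral_cong_AE[where g="\<lambda>\<omega>. V * avg \<omega>"]) auto
  have "variance ?D = expectation (\<lambda>\<omega>. V\<^sup>2 * (avg \<omega>)\<^sup>2)"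
    unfolding m using double_integral_field by (intro integral_cong_AE) (auto simp: power_mult_distrib)
  then show ?thesis using avg_square by simp
qed

lemma c_eq: "c = 2 / T * (LINT \<tau>:{0..T}|lborel. (1 - \<tau> / T) * (LINT z:{0..diameter S}|lborel. C z \<tau> * distance_density S z))"
  unfolding c_def cov_def using covariance_average_eq[OF S_compact C_abs_measurable C_abs_bounds] .

end

section \<open>Homothetic windows and the limit\<close>

lemma compact_homothet: "compact (K :: 'a::real_normed_vector set) \<Longrightarrow> compact (homothet \<gamma> T K)"
  using compact_scaling[of K "T powr \<gamma>"] by (simp add: homothet_def)

lemma measure_homothet:
  fixes K :: "'a::euclidean_space set"
  assumes K: "compact K" and T: "T > 0"
  shows "measure lborel (homothet \<gamma> T K) = T powr (\<gamma> * DIM('a)) * measure lborel K"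
proof -
  have b: "K \<in> sets borel" "homothet \<gamma> T K \<in> sets borel"
    using K compact_homothet[OF K] by (auto intro: borel_compact)
  have "measure lebesgue (homothet \<gamma> T K) = \<bar>T powr \<gamma>\<bar> ^ DIM('a) * measure lebesgue K"
    using measure_lebesgue_affine[of "T powr \<gamma>" 0 K] by (simp add: homothet_def)
  moreover have "\<bar>T powr \<gamma>\<bar> ^ DIM('a) = T powr (\<gamma> * DIM('a))"
    using T by (simp add: powr_realpow[symmetric] powr_powr)
  ultimately show ?thesis using b by (simp add: measure_completion)
qed

lemma convex_body_measure_pos:
  assumes "convex_body K"
  shows "measure lborel K > 0"
proof -
  obtain x r where r: "r > 0" "ball x r \<subseteq> K"
    using assms by (auto simp: convex_body_def mem_interior)
  have "0 < measure lborel (ball x r)" using r by (rule_tac content_ball_pos)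
  also have "\<dots> \<le> measure lborel K"
    using assms r by (intro measure_mono_fmeasurable) (auto simp: convex_body_def fmeasurable_compact)
  finally show ?thesis .
qed

theorem theorem2:
  fixes K :: "(real ^ 'd) set"
    and M :: "'w measure"
    and Z :: "real ^ 'd \<Rightarrow> real \<Rightarrow> 'w \<Rightarrow> real"
    and C :: "real \<Rightarrow> real \<Rightarrow> real"
    and \<gamma> u :: real
  assumes dim: "CARD('d) \<ge> 2"
    and body: "convex_body K" "0 \<in> K"
    and params: "\<gamma> \<ge> 0" "u \<ge> 0"
    and prob: "prob_space M"
    and field: "measurable_field M Z" "mean_square_continuous M Z" "gaussian_field M Z"
      "homogeneous_isotropic_stationary M Z"
    and mean: "\<And>x t. prob_space.expectation M (Z x t) = 0"
    and unit_variance: "\<And>x t. prob_space.expectation M (\<lambda>\<omega>. (Z x t \<omega>)\<^sup>2) = 1"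
    and covariance: "\<And>x t y s.
      prob_space.expectation M (\<lambda>\<omega>. Z x t \<omega> * Z y s \<omega>) = C (norm (x - y)) \<bar>t - s\<bar>"
    and nonneg: "\<And>x t y s. C (norm (x - y :: real ^ 'd)) \<bar>t - s\<bar> \<ge> 0"
    and decay: "\<And>\<epsilon>. \<epsilon> > 0 \<Longrightarrow>
      \<exists>A. \<forall>z\<ge>0. \<forall>\<tau>\<ge>0. max z \<tau> \<ge> A \<longrightarrow> \<bar>C z \<tau>\<bar> < \<epsilon>"
    and growth: "\<exists>\<delta>\<^sub>1\<in>{0<..<1}. \<exists>\<delta>\<^sub>2\<in>{0<..<1}.
      filterlim (\<lambda>T. sigma1_sq M Z K \<gamma> T /
          (T powr (1 + \<delta>\<^sub>1) * T powr (\<gamma> * real CARD('d) * (1 + \<delta>\<^sub>2)))) at_top at_top"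
  shows "converges_in_distribution M
    (\<lambda>T \<omega>.
      (sojourn Z K \<gamma> u T \<omega> -
         (1 - std_normal_cdf u) * measure lborel K * T powr (1 + \<gamma> * real CARD('d))) /
      (std_normal_density u *
         sqrt (2 * (measure lborel K)\<^sup>2 * T powr (1 + 2 * \<gamma> * real CARD('d)) *
           (LINT \<tau>:{0..T}|lborel. (1 - \<tau> / T) *
             (LINT z:{0..diameter (homothet \<gamma> T K)}|lborel.
                C z \<tau> * distance_density (homothet \<gamma> T K) z)))))
    std_normal_distribution at_top"
proof -
  interpret prob_space M by fact
  interpret F: unit_gaussian_field M Z C
    by unfold_locales (fact field mean unit_variance covariance nonneg decay)+
  define d where "d = real CARD('d)"
  define S where "S T = homothet \<gamma> T K" for T
  have compact_K: "compact K" using body(1) by (simp add: convex_body_def)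
  have compact_S: "compact (S T)" for T
    unfolding S_def by (rule compact_homothet[OF compact_K])
  have S_borel [measurable]: "S T \<in> sets borel" for T by (rule borel_compact[OF compact_S])
  have K_pos: "measure lborel K > 0" by (rule convex_body_measure_pos[OF body(1)])
  have S_measure: "measure lborel (S T) = T powr (\<gamma> * d) * measure lborel K" if "T > 0" for T
    unfolding S_def d_def using measure_homothet[OF compact_K that] by simp
  have sampled: "sampled_gaussian_field M Z C (S T) T" if "T > 0" for T
  proof unfold_locales
    have "measure lborel (S T) > 0" using S_measure[OF that] K_pos that by simp
    then show "emeasure lborel (S T) \<noteq> 0" by (auto simp: measure_def)
    show "emeasure lborel (S T) \<noteq> \<infinity>"
      using emeasure_bounded_finite[OF compact_imp_bounded[OF compact_S]] by (simp add: less_top)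
  qed (use that compact_S S_borel in auto)
  define V where "V T = measure lborel K * T powr (1 + \<gamma> * d)" for T
  define J where "J T = (LINT \<tau>:{0..T}|lborel. (1 - \<tau> / T) *
    (LINT z:{0..diameter (S T)}|lborel. C z \<tau> * distance_density (S T) z))" for T
  define c where "c T = 2 / T * J T" for T
  define a where "a = 1 - std_normal_cdf u"
  define Y where "Y T \<omega> = (sojourn Z K \<gamma> u T \<omega> - a * measure lborel K * T powr (1 + \<gamma> * d)) /
    (std_normal_density u * sqrt (2 * (measure lborel K)\<^sup>2 * T powr (1 + 2 * \<gamma> * d) * J T))" for T \<omega>
  have V_pos: "V T > 0" if "T > 0" for T using K_pos that by (simp add: V_def)
  have V_eq: "sampled_gaussian_field.V (S T) T = V T" if "T > 0" for T
    using that by (simp add: sampled_gaussian_field.V_def[OF sampled[OF that]] S_measure V_def powr_add mult_ac)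
  have c_eq: "sampled_gaussian_field.c C (S T) T = c T" if "T > 0" for T
    by (simp add: sampled_gaussian_field.c_eq[OF sampled[OF that]] c_def J_def)
  \<comment> \<open>The exponents match because \<open>T * T powr (1 + 2 * \<gamma> * d)\<close> is
    the square of \<open>T powr (1 + \<gamma> * d)\<close>; the spare \<open>T\<close> is the
    denominator of \<open>2 / T\<close> in \<open>c\<close>.\<close>
  have variance_eq: "2 * (measure lborel K)\<^sup>2 * T powr (1 + 2 * \<gamma> * d) * J T = (V T)\<^sup>2 * c T" if "T > 0" for T
  proof -
    have "T * T powr (1 + 2 * \<gamma> * d) = (T powr (1 + \<gamma> * d))\<^sup>2"
      using that by (simp add: power2_eq_square powr_add[symmetric] powr_mult_base algebra_simps)
    then show ?thesis using that by (simp add: V_def c_def power_mult_distrib field_simps)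
  qed
  have Y_eq: "Y T \<omega> = (sampled_gaussian_field.avg_I Z (S T) T u \<omega> - a) / (std_normal_density u * sqrt (c T))"
    if "T > 0" "\<omega> \<in> space M" for T \<omega>
  proof -
    have "sojourn Z K \<gamma> u T \<omega> = V T * sampled_gaussian_field.avg_I Z (S T) T u \<omega>"
      using sampled_gaussian_field.sojourn_eq[OF sampled[OF that(1)] that(2)] V_eq[OF that(1)]
      by (simp add: sojourn_def S_def)
    then have "sojourn Z K \<gamma> u T \<omega> - a * measure lborel K * T powr (1 + \<gamma> * d) =
        V T * (sampled_gaussian_field.avg_I Z (S T) T u \<omega> - a)"
      by (simp add: V_def right_diff_distrib)
    moreover have "sqrt ((V T)\<^sup>2 * c T) = V T * sqrt (c T)"
      using V_pos[OF that(1)] by (simp add: real_sqrt_mult)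
    ultimately show ?thesis
      unfolding Y_def variance_eq[OF that(1)] using V_pos[OF that(1)] by simp
  qed
  have sigma_eq: "sigma1_sq M Z K \<gamma> T = (V T)\<^sup>2 * c T" if "T > 0" for T
    using sampled_gaussian_field.variance_double_integral[OF sampled[OF that]] V_eq[OF that] c_eq[OF that]
    by (simp add: sigma1_sq_def S_def)
  \<comment> \<open>\<open>V T * c T\<close> is the variance of the integral divided by the volume,
    and for \<open>T \<ge> 1\<close> the volume is at most a constant times the power of
    \<open>T\<close> in the growth condition, because \<open>\<delta>\<^sub>1\<close> and
    \<open>\<delta>\<^sub>2\<close> are positive.\<close>
  have Vc_lim: "filterlim (\<lambda>T. V T * c T) at_top at_top"
  proof -
    obtain \<delta>\<^sub>1 \<delta>\<^sub>2 where \<delta>: "0 < \<delta>\<^sub>1" "0 < \<delta>\<^sub>2"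
      and lim: "filterlim (\<lambda>T. sigma1_sq M Z K \<gamma> T / (T powr (1 + \<delta>\<^sub>1) * T powr (\<gamma> * d * (1 + \<delta>\<^sub>2)))) at_top at_top"
      using growth by (auto simp: d_def)
    have "filterlim (\<lambda>T. 1 / measure lborel K * (sigma1_sq M Z K \<gamma> T / (T powr (1 + \<delta>\<^sub>1) * T powr (\<gamma> * d * (1 + \<delta>\<^sub>2))))) at_top at_top"
      using lim K_pos by (intro filterlim_tendsto_pos_mult_at_top[OF tendsto_const]) auto
    moreover have "\<forall>\<^sub>F T in at_top. 1 / measure lborel K * (sigma1_sq M Z K \<gamma> T / (T powr (1 + \<delta>\<^sub>1) * T powr (\<gamma> * d * (1 + \<delta>\<^sub>2)))) \<le> V T * c T"
      using eventually_ge_at_top[of 1]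
    proof eventually_elim
      case (elim T)
      then have T: "T > 0" by simp
      have "0 \<le> \<gamma> * d" using params by (simp add: d_def)
      then have "1 + \<gamma> * d \<le> (1 + \<delta>\<^sub>1) + \<gamma> * d * (1 + \<delta>\<^sub>2)" using \<delta> by (simp add: distrib_left)
      then have "T powr (1 + \<gamma> * d) \<le> T powr (1 + \<delta>\<^sub>1) * T powr (\<gamma> * d * (1 + \<delta>\<^sub>2))"
        unfolding powr_add[symmetric] using elim by (intro powr_mono) auto
      moreover have "0 \<le> (V T)\<^sup>2 * c T"
        using sampled_gaussian_field.c_nonneg[OF sampled[OF T]] c_eq[OF T] by simp
      ultimately have "(V T)\<^sup>2 * c T / (T powr (1 + \<delta>\<^sub>1) * T powr (\<gamma> * d * (1 + \<delta>\<^sub>2))) \<le> (V T)\<^sup>2 * c T / T powr (1 + \<gamma> * d)"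
        using T by (intro divide_left_mono) auto
      then have "1 / measure lborel K * ((V T)\<^sup>2 * c T / (T powr (1 + \<delta>\<^sub>1) * T powr (\<gamma> * d * (1 + \<delta>\<^sub>2)))) \<le> 1 / measure lborel K * ((V T)\<^sup>2 * c T / T powr (1 + \<gamma> * d))"
        using K_pos by (intro mult_left_mono) auto
      also have "\<dots> = V T * c T" using K_pos T by (simp add: V_def power2_eq_square)
      finally show ?case unfolding sigma_eq[OF T] .
    qed
    ultimately show ?thesis by (rule filterlim_at_top_mono)
  qed
  have Y_measurable: "Y T \<in> borel_measurable M" for T
  proof -
    have "sojourn Z K \<gamma> u T \<in> borel_measurable M"
      unfolding sojourn_def[abs_def] S_def[symmetric] by (rule F.borel_measurable_double_integral) auto
    then show ?thesis unfolding Y_def[abs_def] by measurable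
  qed
  have char_lim: "((\<lambda>T. expectation (\<lambda>\<omega>. iexp (\<theta> * Y T \<omega>))) \<longlongrightarrow> exp (- \<theta>\<^sup>2 / 2)) at_top" for \<theta>
  proof (rule tendstoI)
    fix e :: real assume e: "e > 0"
    define k where "k = \<theta>\<^sup>2 / (std_normal_density u)\<^sup>2"
    \<comment> \<open>Chosen so that \<open>k * (2 * \<epsilon>) < e\<^sup>2\<close>; the summand 1
      keeps the denominator positive when \<open>\<theta> = 0\<close>, where \<open>k\<close>
      vanishes.\<close>
    define \<epsilon> where "\<epsilon> = e\<^sup>2 / (4 * (k + 1))"
    have k: "0 \<le> k" by (simp add: k_def)
    have \<epsilon>: "\<epsilon> > 0" using e k by (simp add: \<epsilon>_def)
    obtain A where A: "A > 0" "\<And>p q. expectation (\<lambda>\<omega>. F.h u p \<omega> * F.h u q \<omega>)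
        \<le> \<epsilon> * F.cov p q + 4 * indicator {(p, q). norm (fst p - fst q) < A \<and> \<bar>snd p - snd q\<bar> < A} (p, q)"
      using F.h_cov_bound[OF params(2) \<epsilon>] by blast
    define D where "D = 8 * A * measure lborel (ball (0 :: real ^ 'd) A)"
    have D: "0 \<le> D" using A(1) by (simp add: D_def)
    \<comment> \<open>The threshold \<open>D / \<epsilon>\<close> brings the share of the close
      pairs down to at most \<open>\<epsilon>\<close>; the 1 guarantees \<open>c T > 0\<close>,
      without which the normalisation would degenerate.\<close>
    have "\<forall>\<^sub>F T in at_top. max 1 (D / \<epsilon>) \<le> V T * c T"
      using Vc_lim unfolding filterlim_at_top by blast
    then show "\<forall>\<^sub>F T in at_top. dist (expectation (\<lambda>\<omega>. iexp (\<theta> * Y T \<omega>))) (exp (- \<theta>\<^sup>2 / 2)) < e"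
      using eventually_gt_at_top[of 0]
    proof eventually_elim
      case (elim T)
      interpret G: sampled_gaussian_field M Z C "S T" T by (rule sampled[OF elim(2)])
      have Vc: "1 \<le> V T * c T" "D / \<epsilon> \<le> V T * c T" using elim(1) by auto
      have c_pos: "c T > 0" using Vc(1) V_pos[OF elim(2)] by (metis less_le_trans zero_less_mult_pos zero_less_one)
      have cG: "G.c = c T" by (rule c_eq[OF elim(2)])
      have VG: "G.V = V T" by (rule V_eq[OF elim(2)])
      have "expectation (\<lambda>\<omega>. (G.avg_h u \<omega>)\<^sup>2) / c T \<le> (\<epsilon> * c T + D / V T) / c T"
        using G.avg_h_square_le[OF A] c_pos unfolding cG VG D_def by (intro divide_right_mono) auto
      also have "\<dots> = \<epsilon> + D / (V T * c T)" using c_pos V_pos[OF elim(2)] by (simp add: field_simps)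
      also have "D / (V T * c T) \<le> \<epsilon>"
        using Vc \<epsilon> by (simp add: field_simps)
      finally have R: "expectation (\<lambda>\<omega>. (G.avg_h u \<omega>)\<^sup>2) / c T \<le> 2 * \<epsilon>" by simp
      have "expectation (\<lambda>\<omega>. iexp (\<theta> * Y T \<omega>)) =
          expectation (\<lambda>\<omega>. iexp (\<theta> * ((G.avg_I u \<omega> - a) / (std_normal_density u * sqrt (c T)))))"
        using Y_eq[OF elim(2)] by (intro Bochner_Integration.integral_cong) auto
      then have "dist (expectation (\<lambda>\<omega>. iexp (\<theta> * Y T \<omega>))) (exp (- \<theta>\<^sup>2 / 2)) \<le>
          sqrt (k * (expectation (\<lambda>\<omega>. (G.avg_h u \<omega>)\<^sup>2) / c T))"
        using G.normalised_char_le[of \<theta> u] c_pos unfolding cG by (simp only: dist_norm a_def k_def)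
      also have "\<dots> \<le> sqrt (k * (2 * \<epsilon>))"
        using R k by (intro real_sqrt_le_mono mult_left_mono)
      also have "\<dots> < e"
      proof (rule real_less_lsqrt)
        have "k * (2 * \<epsilon>) = e\<^sup>2 * (k / (2 * (k + 1)))" using k by (simp add: \<epsilon>_def field_simps)
        also have "\<dots> < e\<^sup>2 * 1" using e k by (intro mult_strict_left_mono) (auto simp: field_simps)
        finally show "k * (2 * \<epsilon>) < e\<^sup>2" by simp
      qed (use e in simp)
      finally show ?case .
    qed
  qed
  have "converges_in_distribution M Y std_normal_distribution at_top"
    unfolding converges_in_distribution_def
  proof (intro allI impI)
    fix x assume x: "isCont (cdf std_normal_distribution) x"
    show "((\<lambda>T. cdf (distr M borel (Y T)) x) \<longlongrightarrow> cdf std_normal_distribution x) at_top"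
    \<comment> \<open>Levy's continuity theorem speaks about sequences, so the limit in
      \<open>T\<close> is tested along arbitrary sequences tending to infinity.\<close>
    proof (rule tendsto_at_topI_sequentially)
      fix T :: "nat \<Rightarrow> real" assume T: "filterlim T at_top sequentially"
      have "weak_conv_m (\<lambda>n. distr M borel (Y (T n))) std_normal_distribution"
      proof (rule levy_continuity)
        show "real_distribution (distr M borel (Y (T n)))" for n
          by (intro real_distribution_distr Y_measurable)
        fix \<theta>
        have "char (distr M borel (Y (T n))) \<theta> = expectation (\<lambda>\<omega>. iexp (\<theta> * Y (T n) \<omega>))" for n
          unfolding char_def using Y_measurable by (subst integral_distr) auto
        then show "(\<lambda>n. char (distr M borel (Y (T n))) \<theta>) \<longlonglongrightarrow> char std_normal_distribution \<theta>"
          using filterlim_compose[OF char_lim T] by (simp add: char_std_normal_distribution)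
      qed (rule real_dist_normal_dist)
      then show "(\<lambda>n. cdf (distr M borel (Y (T n))) x) \<longlonglongrightarrow> cdf std_normal_distribution x"
        using x by (simp add: weak_conv_m_def weak_conv_def)
    qed
  qed
  then show ?thesis
    unfolding Y_def[abs_def] J_def S_def d_def a_def .
qed

end
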